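(* Let $V$ be a $\mathbb{Z}_{\ge 0}$-graded conformal vertex algebra and let $\mathcal{A}\subset V$ be a subvertex algebra satisfying Dijkgraaf's condition. Let $a=a_1\otimes\cdots\otimes a_n\in\mathcal{A}^{\otimes n}$ and let $i,j,k\in\{1,\dots,n\}$ be distinct. Then (1) $B_{i\rightarrow k}B_{j\rightarrow k}a=B_{j\rightarrow k}B_{i\rightarrow k}a$; (2) $[C_{i\rightarrow k},B_{j\rightarrow k}]a+B_{i\rightarrow k}B_{j\rightarrow k}a=B_{j\rightarrow k}C_{i\rightarrow j}a$; (3) $[C_{i\rightarrow k},C_{j\rightarrow k}]a\equiv C_{j\rightarrow k}C_{i\rightarrow j}a-C_{i\rightarrow k}C_{j\rightarrow i}a$ modulo $\operatorname{Im}(T)$, where $T$ acts on the $k$-th tensor factor, i.e. the difference of the two sides lies in $T_k(\mathcal{A}^{\otimes n})$.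
   Context: Conformal vertex algebra: $V=\bigoplus_{n\ge 0}V_n$ is a $\mathbb{Z}_{\ge 0}$-graded conformal vertex algebra over $\mathbb{C}$ with vacuum $|0\rangle\in V_0$, translation operator $T=L_{-1}$ (of degree 1), fields $Y(a,z)=\sum_{n\in\mathbb{Z}}a_{(n)}z^{-n-1}$, conformal vector $\omega\in V_2$ with $Y(\omega,z)=\sum_n L_nz^{-n-2}$, the $L_n$ spanning a Virasoro algebra, and $L_0=n$ on $V_n$. Dijkgraaf's condition on a subvertex algebra $\mathcal{A}\subset V$: $\mathcal{A}\cap V_1=0$, and $a_{(0)}b\in T\mathcal{A}$ for all $a,b\in\mathcal{A}$. Put $\mathcal{A}_{>0}=\mathcal{A}\cap\bigoplus_{n>0}V_n$. The linear operator $T^{-1}:\mathcal{A}_{(0)}\mathcal{A}\to\mathcal{A}_{>0}$, where $\mathcal{A}_{(0)}\mathcal{A}$ is the span of all $a_{(0)}b$ with $a,b\in\mathcal{A}$, is defined by $T^{-1}x=\operatorname{Pr}(c)$ for any $c\in\mathcal{A}$ with $Tc=x$, where $\operatorname{Pr}:V\to\bigoplus_{n>0}V_n$ is the natural projection; it satisfies $T(T^{-1}x)=x$ and is independent of the choice of $c$, since $\ker T\subset V_0$. Operations: for $a,b\in\mathcal{A}$ set $B(a,b)=T^{-1}(a_{(0)}b)$ and $C(a,b)=a_{(1)}b-B(a,b)$. On $\mathcal{A}^{\otimes n}$: $T_i$ applies $T$ to the $i$-th factor; for $i\ne j$, $B_{i\rightarrow j}(a_1\otimes\cdots\otimes a_n)$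 is obtained by replacing the $i$-th factor by $|0\rangle$ and the $j$-th factor by $B(a_i,a_j)$; $C_{i\rightarrow j}(a_1\otimes\cdots\otimes a_n)$ is obtained by replacing the $i$-th factor by $|0\rangle$ and the $j$-th factor by $C(a_i,a_j)$. The bracket denotes the commutator of operators on $\mathcal{A}^{\otimes n}$.
   Formalization: The subvertex algebra A is assumed to be graded (homogeneous components of elements of A lie in A); without this Pr(c) need not lie in A, so T^{-1} need not take values in A_{>0} and B need not be an operation on A. *)

theory Defs
  imports Complex_Main "HOL-Library.Poly_Mapping"
begin

section \<open>Vertex algebras\<close>

text \<open>The underlying abelian group of a vertex algebra is the whole type \<open>'v\<close>;
  \<open>mode V a n b\<close> is \<open>a\<^sub>(\<^sub>n\<^sub>) b\<close>, where \<open>Y(a,z) = \<Sum>\<^sub>n a\<^sub>(\<^sub>n\<^sub>) z^(-n-1)\<close>.\<close>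

record 'v vertex_alg =
  vscale :: "complex \<Rightarrow> 'v \<Rightarrow> 'v"
  vacuum :: 'v
  transl :: "'v \<Rightarrow> 'v"
  mode :: "'v \<Rightarrow> int \<Rightarrow> 'v \<Rightarrow> 'v"

record 'v conformal_vertex_alg = "'v vertex_alg" +
  grade :: "nat \<Rightarrow> 'v set"
  conf :: 'v

text \<open>The axiom \<open>locality\<close> is the coefficient of \<open>z^(-m-1) w^(-n-1)\<close> in
  \<open>(z - w)^N [Y(a,z), Y(b,w)] c = 0\<close>; note that \<open>N\<close> does not depend on \<open>c\<close>.\<close>

locale vertex_algebra =
  fixes V :: "('v::ab_group_add, 'm) vertex_alg_scheme"
  assumes vector_space: "vector_space (vscale V)"
    and transl_linear: "Vector_Spaces.linear (vscale V) (vscale V) (transl V)"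
    and mode_linear_left:
      "Vector_Spaces.linear (vscale V) (vscale V) (\<lambda>a. mode V a n b)"
    and mode_linear_right:
      "Vector_Spaces.linear (vscale V) (vscale V) (\<lambda>b. mode V a n b)"
    and field: "\<exists>N. \<forall>n\<ge>N. mode V a n b = 0"
    and vacuum_mode: "mode V (vacuum V) n a = (if n = -1 then a else 0)"
    and mode_vacuum_creation: "mode V a (-1) (vacuum V) = a"
    and mode_vacuum_nonneg: "n \<ge> 0 \<Longrightarrow> mode V a n (vacuum V) = 0"
    and transl_vacuum: "transl V (vacuum V) = 0"
    and transl_mode:
      "transl V (mode V a n b) - mode V a n (transl V b)
         = vscale V (- of_int n) (mode V a (n - 1) b)"
    and locality:
      "\<exists>N::nat. \<forall>m n c.
         (\<Sum>j\<le>N. vscale V ((-1) ^ j * of_nat (N choose j))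
            (mode V a (m + int N - int j) (mode V b (n + int j) c)
             - mode V b (n + int j) (mode V a (m + int N - int j) c))) = 0"

definition homogeneous_decomposition ::
    "('v::ab_group_add, 'm) conformal_vertex_alg_scheme \<Rightarrow> 'v \<Rightarrow> (nat \<Rightarrow> 'v) \<Rightarrow> bool" where
  "homogeneous_decomposition V v f \<longleftrightarrow>
     (\<forall>n. f n \<in> grade V n) \<and> finite {n. f n \<noteq> 0} \<and> v = (\<Sum>n | f n \<noteq> 0. f n)"

definition virasoro_mode ::
    "('v, 'm) conformal_vertex_alg_scheme \<Rightarrow> int \<Rightarrow> 'v \<Rightarrow> 'v" where
  "virasoro_mode V n = mode V (conf V) (n + 1)"

text \<open>\<open>homogeneous_decomposition\<close> says that \<open>V\<close> is the direct sum of the \<open>V\<^sub>n\<close>;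
  \<open>grade_mode\<close> says that \<open>a\<^sub>(\<^sub>n\<^sub>)\<close> has degree \<open>p - n - 1\<close> for \<open>a \<in> V\<^sub>p\<close>, with
  \<open>V\<^sub>d = 0\<close> for \<open>d < 0\<close>.\<close>

locale graded_conformal_vertex_algebra = vertex_algebra V
  for V :: "('v::ab_group_add, 'm) conformal_vertex_alg_scheme" +
  assumes grade_subspace: "module.subspace (vscale V) (grade V n)"
    and homogeneous_decomposition: "\<exists>!f. homogeneous_decomposition V v f"
    and vacuum_grade: "vacuum V \<in> grade V 0"
    and transl_grade: "a \<in> grade V n \<Longrightarrow> transl V a \<in> grade V (Suc n)"
    and grade_mode:
      "\<lbrakk>a \<in> grade V p; b \<in> grade V q\<rbrakk> \<Longrightarrow>
         (if int p + int q - n - 1 \<ge> 0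
          then mode V a n b \<in> grade V (nat (int p + int q - n - 1))
          else mode V a n b = 0)"
    and conf_grade: "conf V \<in> grade V 2"
    and virasoro:
      "\<exists>c::complex. \<forall>m n v.
         virasoro_mode V m (virasoro_mode V n v) - virasoro_mode V n (virasoro_mode V m v)
         = vscale V (of_int (m - n)) (virasoro_mode V (m + n) v)
           + (if m + n = 0 then vscale V (of_int (m ^ 3 - m) / 12 * c) v else 0)"
    and virasoro_minus_one: "virasoro_mode V (-1) v = transl V v"
    and virasoro_zero: "v \<in> grade V n \<Longrightarrow> virasoro_mode V 0 v = vscale V (of_nat n) v"

definition component ::
    "('v::ab_group_add, 'm) conformal_vertex_alg_scheme \<Rightarrow> 'v \<Rightarrow> nat \<Rightarrow> 'v" where
  "component V v = (THE f. homogeneous_decomposition V v f)"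

text \<open>\<open>Pr : V \<rightarrow> \<Oplus>\<^sub>n\<^sub>>\<^sub>0 V\<^sub>n\<close>\<close>

definition pos_proj ::
    "('v::ab_group_add, 'm) conformal_vertex_alg_scheme \<Rightarrow> 'v \<Rightarrow> 'v" where
  "pos_proj V v = (\<Sum>n | n > 0 \<and> component V v n \<noteq> 0. component V v n)"

section \<open>Subalgebras and Dijkgraaf's condition\<close>

definition subvertex_algebra ::
    "('v::ab_group_add, 'm) vertex_alg_scheme \<Rightarrow> 'v set \<Rightarrow> bool" where
  "subvertex_algebra V A \<longleftrightarrow>
     module.subspace (vscale V) A \<and> vacuum V \<in> A \<and>
     (\<forall>a\<in>A. \<forall>b\<in>A. \<forall>n. mode V a n b \<in> A)"

definition graded_subset ::
    "('v::ab_group_add, 'm) conformal_vertex_alg_scheme \<Rightarrow> 'v set \<Rightarrow> bool" where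
  "graded_subset V A \<longleftrightarrow> (\<forall>a\<in>A. \<forall>n. component V a n \<in> A)"

definition dijkgraaf ::
    "('v::ab_group_add, 'm) conformal_vertex_alg_scheme \<Rightarrow> 'v set \<Rightarrow> bool" where
  "dijkgraaf V A \<longleftrightarrow>
     A \<inter> grade V 1 = {0} \<and> (\<forall>a\<in>A. \<forall>b\<in>A. mode V a 0 b \<in> transl V ` A)"

text \<open>\<open>T_inv V A x\<close> is meaningful for \<open>x \<in> T A\<close>, where it does not depend on the choice of
  the preimage because \<open>ker T \<subseteq> V\<^sub>0\<close>.\<close>

definition T_inv ::
    "('v::ab_group_add, 'm) conformal_vertex_alg_scheme \<Rightarrow> 'v set \<Rightarrow> 'v \<Rightarrow> 'v" where
  "T_inv V A x = pos_proj V (SOME c. c \<in> A \<and> transl V c = x)"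

definition B_prod ::
    "('v::ab_group_add, 'm) conformal_vertex_alg_scheme \<Rightarrow> 'v set \<Rightarrow> 'v \<Rightarrow> 'v \<Rightarrow> 'v" where
  "B_prod V A a b = T_inv V A (mode V a 0 b)"

definition C_prod ::
    "('v::ab_group_add, 'm) conformal_vertex_alg_scheme \<Rightarrow> 'v set \<Rightarrow> 'v \<Rightarrow> 'v \<Rightarrow> 'v" where
  "C_prod V A a b = mode V a 1 b - B_prod V A a b"

section \<open>Tensor powers of a subspace\<close>

text \<open>The tensor power of \<open>A\<close> over the finite index type \<open>'n\<close> is the quotient of the free
  complex vector space on the \<open>'n\<close>-tuples in \<open>A\<close> by the span of the multilinearity relations.
  Its elements are equivalence classes of formal sums.\<close>

definition formal_scale :: "complex \<Rightarrow> ('x \<Rightarrow>\<^sub>0 complex) \<Rightarrow> ('x \<Rightarrow>\<^sub>0 complex)" where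
  "formal_scale c p = Poly_Mapping.map (\<lambda>d. c * d) p"

lemma lookup_formal_scale [simp]:
  "Poly_Mapping.lookup (formal_scale c p) t = c * Poly_Mapping.lookup p t"
  by (simp add: formal_scale_def Poly_Mapping.map.rep_eq when_def)

interpretation formal: vector_space formal_scale
  by unfold_locales (auto intro!: poly_mapping_eqI simp: lookup_add algebra_simps)

definition formal_sums :: "'v set \<Rightarrow> (('n \<Rightarrow> 'v) \<Rightarrow>\<^sub>0 complex) set" where
  "formal_sums A = {p. \<forall>t \<in> Poly_Mapping.keys p. \<forall>l. t l \<in> A}"

definition multilinear_relations ::
    "('v::ab_group_add, 'm) vertex_alg_scheme \<Rightarrow> 'v set \<Rightarrow> (('n \<Rightarrow> 'v) \<Rightarrow>\<^sub>0 complex) set" where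
  "multilinear_relations V A =
     {Poly_Mapping.single (t(l := x + y)) 1
        - Poly_Mapping.single (t(l := x)) 1 - Poly_Mapping.single (t(l := y)) 1
      | t l x y. (\<forall>m. t m \<in> A) \<and> x \<in> A \<and> y \<in> A} \<union>
     {Poly_Mapping.single (t(l := vscale V c x)) 1
        - formal_scale c (Poly_Mapping.single (t(l := x)) 1)
      | t l x c. (\<forall>m. t m \<in> A) \<and> x \<in> A}"

definition tensor_rel ::
    "('v::ab_group_add, 'm) vertex_alg_scheme \<Rightarrow> 'v set
      \<Rightarrow> ((('n \<Rightarrow> 'v) \<Rightarrow>\<^sub>0 complex) \<times> (('n \<Rightarrow> 'v) \<Rightarrow>\<^sub>0 complex)) set" where
  "tensor_rel V A =
     {(p, q). p \<in> formal_sums A \<and> q \<in> formal_sums A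
        \<and> p - q \<in> formal.span (multilinear_relations V A)}"

lemma equiv_tensor_rel: "equiv (formal_sums A) (tensor_rel V A)"
proof (rule equivI)
  show "tensor_rel V A \<subseteq> formal_sums A \<times> formal_sums A"
    by (auto simp: tensor_rel_def)
  show "refl_on (formal_sums A) (tensor_rel V A)"
    by (auto simp: refl_on_def tensor_rel_def formal.span_zero)
  show "sym (tensor_rel V A)"
    by (rule symI) (auto simp: tensor_rel_def dest: formal.span_neg)
  show "trans (tensor_rel V A)"
  proof (rule transI)
    fix p q r assume "(p, q) \<in> tensor_rel V A" "(q, r) \<in> tensor_rel V A"
    then show "(p, r) \<in> tensor_rel V A"
      using formal.span_add[of "p - q" "multilinear_relations V A" "q - r"]
      by (auto simp: tensor_rel_def)
  qed
qed

type_synonym ('n, 'v) tensor = "(('n \<Rightarrow> 'v) \<Rightarrow>\<^sub>0 complex) set"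

definition tensor_power ::
    "('v::ab_group_add, 'm) vertex_alg_scheme \<Rightarrow> 'v set \<Rightarrow> ('n::finite, 'v) tensor set" where
  "tensor_power V A = formal_sums A // tensor_rel V A"

definition pure_tensor ::
    "('v::ab_group_add, 'm) vertex_alg_scheme \<Rightarrow> 'v set \<Rightarrow> ('n::finite \<Rightarrow> 'v)
      \<Rightarrow> ('n, 'v) tensor" where
  "pure_tensor V A t = tensor_rel V A `` {Poly_Mapping.single t 1}"

definition tensor_add ::
    "('v::ab_group_add, 'm) vertex_alg_scheme \<Rightarrow> 'v set
      \<Rightarrow> ('n::finite, 'v) tensor \<Rightarrow> ('n, 'v) tensor \<Rightarrow> ('n, 'v) tensor" where
  "tensor_add V A X Y = (\<Union>p\<in>X. \<Union>q\<in>Y. tensor_rel V A `` {p + q})"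

definition tensor_diff ::
    "('v::ab_group_add, 'm) vertex_alg_scheme \<Rightarrow> 'v set
      \<Rightarrow> ('n::finite, 'v) tensor \<Rightarrow> ('n, 'v) tensor \<Rightarrow> ('n, 'v) tensor" where
  "tensor_diff V A X Y = (\<Union>p\<in>X. \<Union>q\<in>Y. tensor_rel V A `` {p - q})"

text \<open>\<open>tensor_map V A \<phi>\<close> is the linear operator on the tensor power with
  \<open>pure_tensor V A t \<mapsto> pure_tensor V A (\<phi> t)\<close>. It is induced by the linear extension of \<open>\<phi>\<close> to
  formal sums, provided that \<open>\<phi>\<close> preserves tuples in \<open>A\<close> and that
  \<open>pure_tensor V A (\<phi> t)\<close> is multilinear in \<open>t\<close>.\<close>

definition formal_map ::
    "('x \<Rightarrow> 'x) \<Rightarrow> ('x \<Rightarrow>\<^sub>0 complex) \<Rightarrow> ('x \<Rightarrow>\<^sub>0 complex)" where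
  "formal_map \<phi> p =
     (\<Sum>t \<in> Poly_Mapping.keys p. Poly_Mapping.single (\<phi> t) (Poly_Mapping.lookup p t))"

definition tensor_map ::
    "('v::ab_group_add, 'm) vertex_alg_scheme \<Rightarrow> 'v set \<Rightarrow> (('n \<Rightarrow> 'v) \<Rightarrow> ('n \<Rightarrow> 'v))
      \<Rightarrow> ('n::finite, 'v) tensor \<Rightarrow> ('n, 'v) tensor" where
  "tensor_map V A \<phi> X = (\<Union>p\<in>X. tensor_rel V A `` {formal_map \<phi> p})"

definition T_op ::
    "('v::ab_group_add, 'm) vertex_alg_scheme \<Rightarrow> 'v set \<Rightarrow> 'n
      \<Rightarrow> ('n::finite, 'v) tensor \<Rightarrow> ('n, 'v) tensor" where
  "T_op V A i = tensor_map V A (\<lambda>t. t(i := transl V (t i)))"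

definition B_op ::
    "('v::ab_group_add, 'm) conformal_vertex_alg_scheme \<Rightarrow> 'v set \<Rightarrow> 'n \<Rightarrow> 'n
      \<Rightarrow> ('n::finite, 'v) tensor \<Rightarrow> ('n, 'v) tensor" where
  "B_op V A i j = tensor_map V A (\<lambda>t. t(i := vacuum V, j := B_prod V A (t i) (t j)))"

definition C_op ::
    "('v::ab_group_add, 'm) conformal_vertex_alg_scheme \<Rightarrow> 'v set \<Rightarrow> 'n \<Rightarrow> 'n
      \<Rightarrow> ('n::finite, 'v) tensor \<Rightarrow> ('n, 'v) tensor" where
  "C_op V A i j = tensor_map V A (\<lambda>t. t(i := vacuum V, j := C_prod V A (t i) (t j)))"

definition tensor_commutator ::
    "('v::ab_group_add, 'm) vertex_alg_scheme \<Rightarrow> 'v set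
      \<Rightarrow> (('n::finite, 'v) tensor \<Rightarrow> ('n, 'v) tensor)
      \<Rightarrow> (('n, 'v) tensor \<Rightarrow> ('n, 'v) tensor) \<Rightarrow> ('n, 'v) tensor \<Rightarrow> ('n, 'v) tensor" where
  "tensor_commutator V A P Q X = tensor_diff V A (P (Q X)) (Q (P X))"

end

theory Submission
  imports Defs "HOL-Library.Function_Algebras"
begin

text \<open>
Each operator in the statement sends a pure tensor to a pure tensor. After two of them the
factors \<open>i\<close> and \<open>j\<close> are the vacuum, so all terms differ only in factor \<open>k\<close>, and the claims become
three identities in \<open>A\<close>:
  \<^item> \<open>B(a, B(b, c)) = B(b, B(a, c))\<close>;
  \<^item> \<open>C(a, B(b, c)) - B(b, C(a, c)) + B(a, B(b, c)) = B(C(a, b), c)\<close>;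
  \<^item> \<open>C(a, C(b, c)) - C(b, C(a, c)) - C(C(a, b), c) + C(C(b, a), c) \<in> T A\<close>.

The main tool is the commutator formula \<open>[a\<^sub>(\<^sub>m\<^sub>), b\<^sub>(\<^sub>n\<^sub>)] = \<Sum>\<^sub>j (m choose j) (a\<^sub>(\<^sub>j\<^sub>)b)\<^sub>(\<^sub>m\<^sub>+\<^sub>n\<^sub>-\<^sub>j\<^sub>)\<close>
for \<open>m \<ge> 0\<close> (\<open>commutator_formula\<close>). It is derived from locality by Goddard's uniqueness principle
(\<open>field_determined_by_vacuum\<close>): a family of operators that is local with every field is determined
by its effect on the vacuum. The difference of the two sides kills the vacuum, and it is local with
every field by the argument of Dong's lemma (\<open>commutator_local\<close>). Taking \<open>a = \<omega>\<close>, \<open>m = 0\<close> gives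
\<open>(Ta)\<^sub>(\<^sub>n\<^sub>) = -n a\<^sub>(\<^sub>n\<^sub>-\<^sub>1\<^sub>)\<close>.

With \<open>a\<^sub>(\<^sub>0\<^sub>)b = T B(a, b)\<close> the commutator formula reads
\<open>[a\<^sub>(\<^sub>0\<^sub>), b\<^sub>(\<^sub>0\<^sub>)] = 0\<close>,
\<open>[a\<^sub>(\<^sub>1\<^sub>), b\<^sub>(\<^sub>0\<^sub>)] = (a\<^sub>(\<^sub>1\<^sub>)b - B(a, b))\<^sub>(\<^sub>0\<^sub>) = C(a, b)\<^sub>(\<^sub>0\<^sub>)\<close> and
\<open>[a\<^sub>(\<^sub>1\<^sub>), b\<^sub>(\<^sub>1\<^sub>)] = (a\<^sub>(\<^sub>1\<^sub>)b - 2 B(a, b))\<^sub>(\<^sub>1\<^sub>)\<close>.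
The first two identities hold after applying \<open>T\<close>, and \<open>T\<close> is injective on vectors without component
of degree \<open>0\<close> because \<open>ker T \<subseteq> V\<^sub>0\<close> (\<open>transl_injective\<close>). That \<open>a\<^sub>(\<^sub>1\<^sub>)B(b, c)\<close> has no such component
is where \<open>A \<inter> V\<^sub>1 = 0\<close> enters (\<open>component_mode_1\<close>). Expanding the third expression with the help of
the second identity leaves \<open>(b\<^sub>(\<^sub>1\<^sub>)a - B(a, b) - B(b, a))\<^sub>(\<^sub>1\<^sub>)c\<close>. Comparing \<open>[a\<^sub>(\<^sub>1\<^sub>), b\<^sub>(\<^sub>1\<^sub>)]\<close> with
\<open>-[b\<^sub>(\<^sub>1\<^sub>), a\<^sub>(\<^sub>1\<^sub>)]\<close> shows that twice this vector is \<open>(b\<^sub>(\<^sub>1\<^sub>)a - a\<^sub>(\<^sub>1\<^sub>)b)\<^sub>(\<^sub>1\<^sub>)c\<close>. By skew-symmetry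
\<open>b\<^sub>(\<^sub>1\<^sub>)a - a\<^sub>(\<^sub>1\<^sub>)b = Td\<close> with \<open>d \<in> A\<close> (\<open>mode_1_symmetric\<close>), and \<open>(Td)\<^sub>(\<^sub>1\<^sub>)c = -d\<^sub>(\<^sub>0\<^sub>)c \<in> T A\<close>.
\<close>

section \<open>Iterated differences and locality\<close>

text \<open>On the coefficients \<open>G m n\<close> of \<open>z^(-m-1) w^(-n-1)\<close> this is multiplication by \<open>z - w\<close>, so
locality says that a power of it kills the commutator of two fields.\<close>

definition shift_diff :: "(int \<Rightarrow> int \<Rightarrow> 'a::ab_group_add) \<Rightarrow> int \<Rightarrow> int \<Rightarrow> 'a" where
  "shift_diff G m n = G (m + 1) n - G m (n + 1)"

lemma shift_diff_pow_additive:
  assumes h: "\<And>x y. h (x - y) = h x - h y"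
  shows "(shift_diff ^^ N) (\<lambda>m n. h (G m n)) = (\<lambda>m n. h ((shift_diff ^^ N) G m n))"
  by (induction N) (auto simp: fun_eq_iff shift_diff_def h)

lemma shift_diff_pow_diff:
  "(shift_diff ^^ N) (\<lambda>m n. G m n - H m n)
     = (\<lambda>m n. (shift_diff ^^ N) G m n - (shift_diff ^^ N) H m n)"
  by (induction N) (auto simp: fun_eq_iff shift_diff_def)

lemma shift_diff_pow_translate:
  "(shift_diff ^^ N) (\<lambda>m n. G (m + k) n) = (\<lambda>m n. (shift_diff ^^ N) G (m + k) n)"
  by (induction N) (auto simp: fun_eq_iff shift_diff_def algebra_simps)

lemma shift_diff_pow_zero: "(shift_diff ^^ N) (\<lambda>m n. 0) = (\<lambda>m n. 0)"
  by (induction N) (auto simp: fun_eq_iff shift_diff_def)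

lemma shift_diff_pow_mono:
  assumes "(shift_diff ^^ N) G = (\<lambda>m n. 0)" and "N \<le> M"
  shows "(shift_diff ^^ M) G = (\<lambda>m n. 0)"
proof -
  have "(shift_diff ^^ M) G = (shift_diff ^^ (M - N)) ((shift_diff ^^ N) G)"
    using assms(2) by (metis comp_apply funpow_add le_add_diff_inverse2)
  then show ?thesis
    by (simp add: assms(1) shift_diff_pow_zero)
qed

text \<open>For \<open>q = -1\<close> this is the passage to \<open>w = 0\<close>: if only non-negative powers of \<open>w\<close> occur, the constant term in \<open>w\<close> of
\<open>(z - w)^N G\<close> is that of \<open>z^N G\<close>.\<close>

lemma shift_diff_pow_edge:
  assumes "\<And>m n. n > q \<Longrightarrow> G m n = 0"
  shows "(shift_diff ^^ N) G m q = G (m + int N) q"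
proof -
  have "\<forall>m n. n \<ge> q \<longrightarrow> (shift_diff ^^ N) G m n = (if n = q then G (m + int N) q else 0)"
    by (induction N) (auto simp: shift_diff_def assms algebra_simps)
  then show ?thesis by simp
qed

definition finite_order :: "(int \<Rightarrow> int \<Rightarrow> 'a::ab_group_add) \<Rightarrow> bool" where
  "finite_order G \<longleftrightarrow> (\<exists>N. (shift_diff ^^ N) G = (\<lambda>m n. 0))"

lemma finite_order_diff:
  assumes "finite_order G" and "finite_order H"
  shows "finite_order (\<lambda>m n. G m n - H m n)"
proof -
  obtain M N where "(shift_diff ^^ M) G = (\<lambda>m n. 0)" "(shift_diff ^^ N) H = (\<lambda>m n. 0)"
    using assms unfolding finite_order_def by blast
  then have "(shift_diff ^^ max M N) (\<lambda>m n. G m n - H m n) = (\<lambda>m n. 0)"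
    using shift_diff_pow_mono[of M G "max M N"] shift_diff_pow_mono[of N H "max M N"]
    by (simp add: shift_diff_pow_diff)
  then show ?thesis unfolding finite_order_def by blast
qed

lemma finite_order_zero: "finite_order (\<lambda>m n. 0)"
  unfolding finite_order_def using shift_diff_pow_zero by blast

lemma finite_order_sum:
  assumes "finite S" and "\<And>j. j \<in> S \<Longrightarrow> finite_order (G j)"
  shows "finite_order (\<lambda>m n. \<Sum>j\<in>S. G j m n)"
  using assms
proof (induction S)
  case (insert s S)
  have "finite_order (\<lambda>m n. G s m n - (0 - (\<Sum>j\<in>S. G j m n)))"
    by (intro finite_order_diff finite_order_zero) (use insert in auto)
  then show ?case using insert.hyps by simp
qed (simp add: finite_order_zero)

lemma finite_order_additive:
  assumes "finite_order G" and "\<And>x y. h (x - y) = h x - h y"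
  shows "finite_order (\<lambda>m n. h (G m n))"
proof -
  have "h 0 = 0" using assms(2)[of 0 0] by simp
  then show ?thesis
    using assms(1) shift_diff_pow_additive[of h, OF assms(2)] unfolding finite_order_def
    by (metis (no_types, lifting))
qed

lemma finite_order_translate:
  "finite_order G \<Longrightarrow> finite_order (\<lambda>m n. G (m + k) n)"
  unfolding finite_order_def shift_diff_pow_translate by metis

text \<open>Every term of the binomial expansion of \<open>(P - Q)^(i + j)\<close> contains \<open>Q^i\<close> or \<open>P^j\<close>. The induction
on \<open>i + j\<close>, applied to \<open>P x\<close> and \<open>Q x\<close>, replaces the expansion.\<close>

lemma funpow_difference_vanish:
  fixes P Q R :: "'g::ab_group_add \<Rightarrow> 'g"
  assumes R: "\<And>x. R x = P x - Q x" and comm: "\<And>x. P (Q x) = Q (P x)"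
    and P: "\<And>x y. P (x - y) = P x - P y" and Q: "\<And>x y. Q (x - y) = Q x - Q y"
    and "(Q ^^ i) x = 0" and "(P ^^ j) x = 0"
  shows "(R ^^ (i + j)) x = 0"
proof -
  have P0: "P 0 = 0" and Q0: "Q 0 = 0"
    using P[of 0 0] Q[of 0 0] by auto
  have "R (x - y) = R x - R y" for x y
    by (simp add: R P Q)
  then have R_diff: "(R ^^ N) (x - y) = (R ^^ N) x - (R ^^ N) y" for N x y
    by (induction N) simp_all
  have R0: "(R ^^ N) 0 = 0" for N using R_diff[of N 0 0] by simp
  have QP: "(Q ^^ N) (P x) = P ((Q ^^ N) x)" for N x
    by (induction N) (auto simp: comm)
  have PQ: "(P ^^ N) (Q x) = Q ((P ^^ N) x)" for N x
    by (induction N) (auto simp: comm)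
  have "\<lbrakk>(Q ^^ i) x = 0; (P ^^ j) x = 0; i + j = N\<rbrakk> \<Longrightarrow> (R ^^ N) x = 0" for N i j x
  proof (induction N arbitrary: i j x)
    case (Suc N)
    show ?case
    proof (cases "i = 0 \<or> j = 0")
      case True
      then have "x = 0" using Suc.prems by auto
      then show ?thesis by (simp only: R0)
    next
      case False
      then obtain i' j' where ij: "i = Suc i'" "j = Suc j'"
        by (metis not0_implies_Suc)
      have 1: "(Q ^^ i) (P x) = 0" and 2: "(P ^^ j) (Q x) = 0"
        using Suc.prems by (simp_all only: QP PQ P0 Q0)
      have 3: "(P ^^ j') (P x) = 0" and 4: "(Q ^^ i') (Q x) = 0"
        using Suc.prems by (simp_all add: ij funpow_Suc_right del: funpow.simps)
      have "i + j' = N" and "i' + j = N"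
        using Suc.prems ij by auto
      then have "(R ^^ N) (P x) = 0" and "(R ^^ N) (Q x) = 0"
        using Suc.IH[OF 1 3] Suc.IH[OF 4 2] by simp_all
      then show ?thesis
        by (simp add: funpow_Suc_right R[of x] R_diff del: funpow.simps)
    qed
  qed auto
  then show ?thesis using assms(5,6) by blast
qed

text \<open>In three variables \<open>x, z, w\<close> the following are the multiplications by \<open>x - z\<close>, \<open>x - w\<close> and
\<open>z - w\<close>.\<close>

definition diff12 :: "(int \<Rightarrow> int \<Rightarrow> int \<Rightarrow> 'a::ab_group_add) \<Rightarrow> int \<Rightarrow> int \<Rightarrow> int \<Rightarrow> 'a" where
  "diff12 F m n q = F (m + 1) n q - F m (n + 1) q"

definition diff13 :: "(int \<Rightarrow> int \<Rightarrow> int \<Rightarrow> 'a::ab_group_add) \<Rightarrow> int \<Rightarrow> int \<Rightarrow> int \<Rightarrow> 'a" where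
  "diff13 F m n q = F (m + 1) n q - F m n (q + 1)"

definition diff23 :: "(int \<Rightarrow> int \<Rightarrow> int \<Rightarrow> 'a::ab_group_add) \<Rightarrow> int \<Rightarrow> int \<Rightarrow> int \<Rightarrow> 'a" where
  "diff23 F m n q = F m (n + 1) q - F m n (q + 1)"

lemma diff12_pow: "(diff12 ^^ N) F m n q = (shift_diff ^^ N) (\<lambda>m n. F m n q) m n"
  by (induction N arbitrary: m n q) (auto simp: diff12_def shift_diff_def)

lemma diff13_pow: "(diff13 ^^ N) F m n q = (shift_diff ^^ N) (\<lambda>m q. F m n q) m q"
  by (induction N arbitrary: m n q) (auto simp: diff13_def shift_diff_def)

lemma diff23_pow: "(diff23 ^^ N) F m n q = (shift_diff ^^ N) (F m) n q"
  by (induction N arbitrary: m n q) (auto simp: diff23_def shift_diff_def)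

lemma diff23_pow_commute: "(diff23 ^^ N) (diff13 F) = diff13 ((diff23 ^^ N) F)"
  "(diff23 ^^ N) (diff12 F) = diff12 ((diff23 ^^ N) F)"
  by (induction N) (auto simp: fun_eq_iff diff12_def diff13_def diff23_def)

lemma diff13_pow_diff: "(diff13 ^^ N) (F - G) = (diff13 ^^ N) F - (diff13 ^^ N) G"
  by (induction N) (auto simp: fun_eq_iff diff13_def)

text \<open>The algebraic core of Dong's lemma. Multiplication by \<open>(z - w)^s\<close> removes \<open>F\<close>; what remains of
\<open>E\<close> is killed by powers of \<open>x - z\<close> and of \<open>x - w\<close>, hence by a power of their difference
\<open>z - w\<close>.\<close>

lemma diff_triple_vanish:
  fixes E :: "int \<Rightarrow> int \<Rightarrow> int \<Rightarrow> 'a::ab_group_add"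
  assumes "(diff12 ^^ r) E = 0" and "E = F - G"
    and F: "(diff23 ^^ s) F = 0" and G: "(diff13 ^^ t) G = 0"
  shows "(diff23 ^^ (r + t + s)) E = 0"
proof -
  have pow_comm: "(diff23 ^^ N) ((diff13 ^^ M) H) = (diff13 ^^ M) ((diff23 ^^ N) H)"
    "(diff23 ^^ N) ((diff12 ^^ M) H) = (diff12 ^^ M) ((diff23 ^^ N) H)"
    for M N and H :: "int \<Rightarrow> int \<Rightarrow> int \<Rightarrow> 'a"
    by (induction M) (auto simp: diff23_pow_commute)
  have zero: "(diff13 ^^ M) (0::int \<Rightarrow> int \<Rightarrow> int \<Rightarrow> 'a) = 0"
    "(diff12 ^^ M) (0::int \<Rightarrow> int \<Rightarrow> int \<Rightarrow> 'a) = 0"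
    "(diff23 ^^ M) (0::int \<Rightarrow> int \<Rightarrow> int \<Rightarrow> 'a) = 0" for M
    by (induction M) (auto simp: fun_eq_iff diff12_def diff13_def diff23_def)
  have diff23_diff: "(diff23 ^^ M) (H - K) = (diff23 ^^ M) H - (diff23 ^^ M) K"
    for M and H K :: "int \<Rightarrow> int \<Rightarrow> int \<Rightarrow> 'a"
    by (induction M) (auto simp: fun_eq_iff diff23_def)
  \<comment> \<open>Multiply by the power of \<open>z - w\<close> that kills \<open>F\<close>.\<close>
  define E' where "E' = (diff23 ^^ s) E"
  have 12: "(diff12 ^^ r) E' = 0"
    unfolding E'_def by (simp add: pow_comm(2)[symmetric] assms(1) zero)
  have "E' = 0 - (diff23 ^^ s) G"
    unfolding E'_def assms(2) by (simp add: diff23_diff F)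
  then have "(diff13 ^^ t) E' = (diff13 ^^ t) 0 - (diff13 ^^ t) ((diff23 ^^ s) G)"
    by (simp only: diff13_pow_diff)
  also have "\<dots> = 0"
    unfolding pow_comm(1)[symmetric] G zero by simp
  finally have 13: "(diff13 ^^ t) E' = 0" .
  have "(diff23 ^^ (r + t)) E' = 0"
    by (rule funpow_difference_vanish[where P = diff13 and Q = diff12])
      (use 12 13 in \<open>auto simp: fun_eq_iff diff12_def diff13_def diff23_def\<close>)
  then show ?thesis
    unfolding E'_def by (simp add: funpow_add)
qed

section \<open>Commutator formula\<close>

context vertex_algebra
begin

sublocale vs: vector_space "vscale V"
  by (rule vector_space)

lemma mode_left:
  "mode V (a + b) n c = mode V a n c + mode V b n c"
  "mode V (a - b) n c = mode V a n c - mode V b n c"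
  "mode V (vscale V s a) n c = vscale V s (mode V a n c)"
  "mode V 0 n c = 0"
  "mode V (- a) n c = - mode V a n c"
  "mode V (\<Sum>x\<in>S. f x) n c = (\<Sum>x\<in>S. mode V (f x) n c)"
proof -
  interpret l: Vector_Spaces.linear "vscale V" "vscale V" "\<lambda>a. mode V a n c"
    by (rule mode_linear_left)
  show "mode V (a + b) n c = mode V a n c + mode V b n c"
    "mode V (a - b) n c = mode V a n c - mode V b n c"
    "mode V (vscale V s a) n c = vscale V s (mode V a n c)"
    "mode V 0 n c = 0" "mode V (- a) n c = - mode V a n c"
    "mode V (\<Sum>x\<in>S. f x) n c = (\<Sum>x\<in>S. mode V (f x) n c)"
    by (rule l.add l.diff l.scale l.zero l.neg l.sum)+
qed

lemma mode_right:
  "mode V c n (a + b) = mode V c n a + mode V c n b"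
  "mode V c n (a - b) = mode V c n a - mode V c n b"
  "mode V c n (vscale V s a) = vscale V s (mode V c n a)"
  "mode V c n 0 = 0"
  "mode V c n (- a) = - mode V c n a"
  "mode V c n (\<Sum>x\<in>S. f x) = (\<Sum>x\<in>S. mode V c n (f x))"
proof -
  interpret l: Vector_Spaces.linear "vscale V" "vscale V" "\<lambda>a. mode V c n a"
    by (rule mode_linear_right)
  show "mode V c n (a + b) = mode V c n a + mode V c n b"
    "mode V c n (a - b) = mode V c n a - mode V c n b"
    "mode V c n (vscale V s a) = vscale V s (mode V c n a)"
    "mode V c n 0 = 0" "mode V c n (- a) = - mode V c n a"
    "mode V c n (\<Sum>x\<in>S. f x) = (\<Sum>x\<in>S. mode V c n (f x))"
    by (rule l.add l.diff l.scale l.zero l.neg l.sum)+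
qed

lemma transl_simps:
  "transl V (a + b) = transl V a + transl V b"
  "transl V (a - b) = transl V a - transl V b"
  "transl V (vscale V s a) = vscale V s (transl V a)"
  "transl V 0 = 0"
  "transl V (- a) = - transl V a"
  "transl V (\<Sum>x\<in>S. f x) = (\<Sum>x\<in>S. transl V (f x))"
proof -
  interpret l: Vector_Spaces.linear "vscale V" "vscale V" "transl V"
    by (rule transl_linear)
  show "transl V (a + b) = transl V a + transl V b"
    "transl V (a - b) = transl V a - transl V b"
    "transl V (vscale V s a) = vscale V s (transl V a)"
    "transl V 0 = 0" "transl V (- a) = - transl V a"
    "transl V (\<Sum>x\<in>S. f x) = (\<Sum>x\<in>S. transl V (f x))"
    by (rule l.add l.diff l.scale l.zero l.neg l.sum)+
qed

text \<open>The binomial expansion of \<open>(z - w)^N\<close>, which is the form in which the locality axiom is stated.\<close>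

lemma shift_diff_pow_binomial:
  "(shift_diff ^^ N) G m n
     = (\<Sum>j\<le>N. vscale V ((-1) ^ j * of_nat (N choose j)) (G (m + int N - int j) (n + int j)))"
proof (induction N arbitrary: m n)
  case (Suc N)
  let ?c = "\<lambda>N j. (-1) ^ j * of_nat (N choose j) :: complex"
  let ?G = "\<lambda>j. G (m + int (Suc N) - int j) (n + int j)"
  have "(\<Sum>j\<le>N. vscale V (?c N j) (G (m + 1 + int N - int j) (n + int j)))
      = (\<Sum>j\<le>Suc N. vscale V (?c N j) (?G j))"
    by (simp add: algebra_simps)
  also have "\<dots> = ?G 0 + (\<Sum>j\<le>N. vscale V (?c N (Suc j)) (?G (Suc j)))"
    by (subst sum.atMost_Suc_shift) simp
  finally have 1: "(\<Sum>j\<le>N. vscale V (?c N j) (G (m + 1 + int N - int j) (n + int j)))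
      = ?G 0 + (\<Sum>j\<le>N. vscale V (?c N (Suc j)) (?G (Suc j)))" .
  have "(shift_diff ^^ Suc N) G m n
      = ?G 0 + (\<Sum>j\<le>N. vscale V (?c N (Suc j)) (?G (Suc j)))
        - (\<Sum>j\<le>N. vscale V (?c N j) (G (m + int N - int j) (n + 1 + int j)))"
    by (simp add: shift_diff_def Suc.IH 1)
  also have "\<dots> = ?G 0 + (\<Sum>j\<le>N. vscale V (?c (Suc N) (Suc j)) (?G (Suc j)))"
  proof -
    have "(\<Sum>j\<le>N. vscale V (?c N (Suc j)) (?G (Suc j)))
        - (\<Sum>j\<le>N. vscale V (?c N j) (G (m + int N - int j) (n + 1 + int j)))
       = (\<Sum>j\<le>N. vscale V (?c (Suc N) (Suc j)) (?G (Suc j)))"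
      unfolding sum_subtractf[symmetric]
    proof (rule sum.cong)
      fix j
      have "G (m + int N - int j) (n + 1 + int j) = ?G (Suc j)"
        by (simp add: algebra_simps)
      then show "vscale V (?c N (Suc j)) (?G (Suc j))
          - vscale V (?c N j) (G (m + int N - int j) (n + 1 + int j))
        = vscale V (?c (Suc N) (Suc j)) (?G (Suc j))"
        by (simp only: vs.scale_left_diff_distrib[symmetric]) (simp add: algebra_simps)
    qed simp
    then show ?thesis by (simp add: add_diff_eq[symmetric])
  qed
  also have "\<dots> = (\<Sum>j\<le>Suc N. vscale V (?c (Suc N) j) (?G j))"
    by (subst sum.atMost_Suc_shift) simp
  finally show ?case .
qed (simp)

lemma locality_finite_order:
  "\<exists>N. \<forall>v. (shift_diff ^^ N) (\<lambda>m n. mode V a m (mode V b n v) - mode V b n (mode V a m v))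
     = (\<lambda>m n. 0)"
  using locality[of a b] unfolding shift_diff_pow_binomial fun_eq_iff by meson

text \<open>By iteration \<open>a\<^sub>(\<^sub>-\<^sub>1\<^sub>-\<^sub>k\<^sub>)|0\<rangle> = T^k a / k!\<close>, the coefficients of \<open>Y(a,z)|0\<rangle> = e^(zT) a\<close>.\<close>

lemma vacuum_mode_neg:
  "mode V a (- 1 - int (Suc k)) (vacuum V)
     = vscale V (1 / of_nat (Suc k)) (transl V (mode V a (- 1 - int k) (vacuum V)))"
proof -
  have "transl V (mode V a (- 1 - int k) (vacuum V))
      = vscale V (of_nat (Suc k)) (mode V a (- 1 - int (Suc k)) (vacuum V))"
    using transl_mode[of a "- 1 - int k" "vacuum V"]
    by (simp add: transl_vacuum mode_right algebra_simps)
  moreover have "(of_nat (Suc k) :: complex) \<noteq> 0" by (rule of_nat_neq_0)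
  ultimately show ?thesis by (simp del: of_nat_Suc)
qed

lemma transl_conv_mode: "transl V a = mode V a (-2) (vacuum V)"
  using vacuum_mode_neg[of a 0] by (simp add: mode_vacuum_creation)

text \<open>Goddard's uniqueness principle. Since \<open>X(z)\<close> kills the vacuum,
\<open>(z - w)^N X(z) Y(d,w)|0\<rangle> = (z - w)^N Y(d,w) X(z)|0\<rangle> = 0\<close>, and \<open>w = 0\<close> gives \<open>z^N X(z) d = 0\<close>.\<close>

lemma field_determined_by_vacuum:
  assumes vac: "\<And>n. X n (vacuum V) = 0" and zero: "\<And>n. X n 0 = 0"
    and local: "finite_order (\<lambda>n q. X n (mode V d q (vacuum V)) - mode V d q (X n (vacuum V)))"
  shows "X n d = 0"
proof -
  let ?G = "\<lambda>n q. X n (mode V d q (vacuum V)) - mode V d q (X n (vacuum V))"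
  obtain N where N: "(shift_diff ^^ N) ?G = (\<lambda>m n. 0)"
    using local unfolding finite_order_def by blast
  have "?G m q = 0" if "q > -1" for m q
    using that by (simp add: vac zero mode_vacuum_nonneg mode_right)
  \<comment> \<open>The edge is at \<open>q = -1\<close>, where \<open>d\<^sub>(\<^sub>-\<^sub>1\<^sub>)|0\<rangle> = d\<close>; larger \<open>q\<close> kill the vacuum.\<close>
  from shift_diff_pow_edge[of "-1" ?G, OF this, of N "n - int N"] show ?thesis
    unfolding N by (simp add: vac mode_vacuum_creation mode_right)
qed

text \<open>The instance of Dong's lemma needed for the commutator formula: the coefficients in \<open>z\<close> of
\<open>[a\<^sub>(\<^sub>m\<^sub>), Y(b,z)]\<close> form a family that is local with \<open>Y(d,w)\<close>. By the Jacobi identity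
\<open>[[a, b], d] = [a, [b, d]] - [b, [a, d]]\<close>, and the three commutators \<open>[a, b]\<close>, \<open>[b, d]\<close>, \<open>[a, d]\<close> are
killed by powers of \<open>x - z\<close>, \<open>z - w\<close>, \<open>x - w\<close>.\<close>

lemma commutator_local:
  "finite_order (\<lambda>n q.
     (mode V a m (mode V b n (mode V d q v)) - mode V b n (mode V a m (mode V d q v)))
     - mode V d q (mode V a m (mode V b n v) - mode V b n (mode V a m v)))"
proof -
  let ?comm = "\<lambda>x y m n v. mode V x m (mode V y n v) - mode V y n (mode V x m v)"
  obtain r where r: "\<And>v. (shift_diff ^^ r) (\<lambda>m n. ?comm a b m n v) = (\<lambda>m n. 0)"
    using locality_finite_order by blast
  obtain s where s: "\<And>v. (shift_diff ^^ s) (\<lambda>m n. ?comm b d m n v) = (\<lambda>m n. 0)"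
    using locality_finite_order by blast
  obtain t where t: "\<And>v. (shift_diff ^^ t) (\<lambda>m n. ?comm a d m n v) = (\<lambda>m n. 0)"
    using locality_finite_order by blast
  define E where "E = (\<lambda>m n q. ?comm a b m n (mode V d q v) - mode V d q (?comm a b m n v))"
  define F where "F = (\<lambda>m n q. mode V a m (?comm b d n q v) - ?comm b d n q (mode V a m v))"
  define G where "G = (\<lambda>m n q. mode V b n (?comm a d m q v) - ?comm a d m q (mode V b n v))"
  have "(diff12 ^^ r) E = 0"
  proof (intro ext)
    fix m n q
    have "(shift_diff ^^ r) (\<lambda>m n. mode V d q (?comm a b m n v)) = (\<lambda>m n. 0)"
      by (subst shift_diff_pow_additive[where h = "mode V d q"]) (simp_all add: mode_right r)
    then show "(diff12 ^^ r) E m n q = 0 m n q"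
      unfolding diff12_pow E_def by (subst shift_diff_pow_diff) (simp add: r)
  qed
  moreover have "E = F - G"
    by (simp add: fun_eq_iff E_def F_def G_def mode_right algebra_simps)
  moreover have "(diff23 ^^ s) F = 0"
  proof (intro ext)
    fix m n q
    have "(shift_diff ^^ s) (\<lambda>n q. mode V a m (?comm b d n q v)) = (\<lambda>m n. 0)"
      by (subst shift_diff_pow_additive[where h = "mode V a m"]) (simp_all add: mode_right s)
    then show "(diff23 ^^ s) F m n q = 0 m n q"
      unfolding diff23_pow F_def by (subst shift_diff_pow_diff) (simp add: s)
  qed
  moreover have "(diff13 ^^ t) G = 0"
  proof (intro ext)
    fix m n q
    have "(shift_diff ^^ t) (\<lambda>m q. mode V b n (?comm a d m q v)) = (\<lambda>m n. 0)"
      by (subst shift_diff_pow_additive[where h = "mode V b n"]) (simp_all add: mode_right t)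
    then show "(diff13 ^^ t) G m n q = 0 m n q"
      unfolding diff13_pow G_def by (subst shift_diff_pow_diff) (simp add: t)
  qed
  ultimately have "(diff23 ^^ (r + t + s)) E = 0" by (rule diff_triple_vanish)
  then have "(shift_diff ^^ (r + t + s)) (E m) = (\<lambda>n q. 0)"
    by (simp add: fun_eq_iff diff23_pow)
  then show ?thesis unfolding finite_order_def E_def by blast
qed

text \<open>Since \<open>a\<^sub>(\<^sub>m\<^sub>)\<close> kills the vacuum, this is the commutator formula evaluated there. Passing from
\<open>k\<close> to \<open>k + 1\<close> means applying \<open>T\<close> and using \<open>[T, a\<^sub>(\<^sub>m\<^sub>)] = -m a\<^sub>(\<^sub>m\<^sub>-\<^sub>1\<^sub>)\<close>; the coefficients match because
\<open>m (m - 1 choose j) = (m - j) (m choose j)\<close>.\<close>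

lemma commutator_vacuum:
  "mode V a (int m) (mode V b (- 1 - int k) (vacuum V))
     = (\<Sum>j\<le>m. vscale V (of_nat (m choose j))
          (mode V (mode V a (int j) b) (int m - 1 - int k - int j) (vacuum V)))"
proof (induction k arbitrary: m)
  case 0
  have "(\<Sum>j\<le>m. vscale V (of_nat (m choose j))
          (mode V (mode V a (int j) b) (int m - 1 - int 0 - int j) (vacuum V)))
      = (\<Sum>j\<le>m. if j = m then mode V a (int m) b else 0)"
    by (rule sum.cong) (auto simp: mode_vacuum_creation mode_vacuum_nonneg)
  then show ?case by (simp add: mode_vacuum_creation)
next
  case (Suc k)
  let ?x = "\<lambda>j i. mode V (mode V a (int j) b) i (vacuum V)"
  let ?rhs = "\<Sum>j\<le>m. vscale V (of_nat (m choose j)) (?x j (int m - 1 - int (Suc k) - int j))"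
  have T: "transl V (?x j i) = vscale V (- of_int i) (?x j (i - 1))" for j i
    using transl_mode[of _ i "vacuum V"] by (simp add: transl_vacuum mode_right)
  have pred: "vscale V (of_nat m) (mode V a (int m - 1) (mode V b (- 1 - int k) (vacuum V)))
     = (\<Sum>j\<le>m. vscale V (of_nat (m - j) * of_nat (m choose j))
          (?x j (int m - 1 - int (Suc k) - int j)))"
  proof (cases m)
    case (Suc m')
    have "vscale V (of_nat m) (mode V a (int m - 1) (mode V b (- 1 - int k) (vacuum V)))
       = (\<Sum>j\<le>m'. vscale V (of_nat m * of_nat (m' choose j))
          (?x j (int m' - 1 - int k - int j)))"
    proof -
      have "int m - 1 = int m'" using Suc by simp
      then show ?thesis
        using Suc.IH[of m'] by (simp only: vs.scale_sum_right vs.scale_scale)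
    qed
    also have "\<dots> = (\<Sum>j\<le>m'. vscale V (of_nat (m - j) * of_nat (m choose j))
          (?x j (int m - 1 - int (Suc k) - int j)))"
    proof (rule sum.cong)
      fix j assume "j \<in> {..m'}"
      then have "m * (m' choose j) = (m - j) * (m choose j)"
        using binomial_absorb_comp[of m j] Suc by simp
      then have "(of_nat m * of_nat (m' choose j) :: complex) = of_nat (m - j) * of_nat (m choose j)"
        by (metis of_nat_mult)
      moreover have "int m' - 1 - int k - int j = int m - 1 - int (Suc k) - int j"
        using Suc by simp
      ultimately show "vscale V (of_nat m * of_nat (m' choose j)) (?x j (int m' - 1 - int k - int j))
        = vscale V (of_nat (m - j) * of_nat (m choose j)) (?x j (int m - 1 - int (Suc k) - int j))"
        by (rule arg_cong2[where f = "\<lambda>c i. vscale V c (?x j i)"])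
    qed simp
    also have "\<dots> = (\<Sum>j\<le>m. vscale V (of_nat (m - j) * of_nat (m choose j))
          (?x j (int m - 1 - int (Suc k) - int j)))"
      using Suc by simp
    finally show ?thesis .
  qed simp
  have "vscale V (of_nat (Suc k)) (mode V b (- 1 - int (Suc k)) (vacuum V))
      = transl V (mode V b (- 1 - int k) (vacuum V))"
    unfolding vacuum_mode_neg by (simp del: of_nat_Suc)
  then have "vscale V (of_nat (Suc k)) (mode V a (int m) (mode V b (- 1 - int (Suc k)) (vacuum V)))
      = mode V a (int m) (transl V (mode V b (- 1 - int k) (vacuum V)))"
    by (metis mode_right(3))
  also have "\<dots> = transl V (mode V a (int m) (mode V b (- 1 - int k) (vacuum V)))
      + vscale V (of_nat m) (mode V a (int m - 1) (mode V b (- 1 - int k) (vacuum V)))"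
    using transl_mode[of a "int m" "mode V b (- 1 - int k) (vacuum V)"]
    by (simp add: algebra_simps)
  also have "\<dots> = (\<Sum>j\<le>m. vscale V (of_nat (m choose j) * (- of_int (int m - 1 - int k - int j)))
          (?x j (int m - 1 - int (Suc k) - int j)))
      + (\<Sum>j\<le>m. vscale V (of_nat (m - j) * of_nat (m choose j))
          (?x j (int m - 1 - int (Suc k) - int j)))"
    unfolding pred Suc.IH transl_simps T by (simp add: algebra_simps)
  also have "\<dots> = (\<Sum>j\<le>m. vscale V (of_nat (Suc k))
        (vscale V (of_nat (m choose j)) (?x j (int m - 1 - int (Suc k) - int j))))"
    unfolding sum.distrib[symmetric] vs.scale_left_distrib[symmetric] vs.scale_scale
    by (rule sum.cong) (auto simp: of_nat_diff algebra_simps intro!: arg_cong2[of _ _ _ _ "vscale V"])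
  also have "\<dots> = vscale V (of_nat (Suc k)) ?rhs"
    by (simp add: vs.scale_sum_right)
  finally show ?case
    using of_nat_neq_0[of k, where 'a = complex]
    by (simp only: vs.scale_cancel_left simp_thms)
qed

theorem commutator_formula:
  "mode V a (int m) (mode V b n v) - mode V b n (mode V a (int m) v)
     = (\<Sum>j\<le>m. vscale V (of_nat (m choose j)) (mode V (mode V a (int j) b) (int m + n - int j) v))"
proof -
  define S where "S n v = (\<Sum>j\<le>m. vscale V (of_nat (m choose j))
    (mode V (mode V a (int j) b) (int m + n - int j) v))" for n v
  define X where "X n v = mode V a (int m) (mode V b n v) - mode V b n (mode V a (int m) v)
    - S n v" for n v
  have "X n d = 0" for n d
  proof (rule field_determined_by_vacuum[where X = X])
    fix n
    show "X n 0 = 0" by (simp add: X_def S_def mode_right)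
    show "X n (vacuum V) = 0"
    proof (cases "n \<ge> 0")
      case True
      then have "S n (vacuum V) = 0"
        unfolding S_def by (intro sum.neutral) (simp add: mode_vacuum_nonneg)
      then show ?thesis
        using True by (simp add: X_def mode_vacuum_nonneg mode_right)
    next
      case False
      then have "n = - 1 - int (nat (- 1 - n))" by simp
      then obtain k where "n = - 1 - int k" ..
      then show ?thesis
        using commutator_vacuum[of a m b k]
        by (simp add: X_def S_def mode_vacuum_nonneg mode_right add_diff_eq)
    qed
  next
    have "finite_order (\<lambda>n q. S n (mode V d q (vacuum V)) - mode V d q (S n (vacuum V)))"
    proof -
      have "finite_order (\<lambda>n q. vscale V (of_nat (m choose j))
          (mode V (mode V a (int j) b) (n + (int m - int j)) (mode V d q (vacuum V))
           - mode V d q (mode V (mode V a (int j) b) (n + (int m - int j)) (vacuum V))))" for j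
      proof (rule finite_order_additive[where h = "vscale V (of_nat (m choose j))"],
          rule finite_order_translate)
        show "finite_order (\<lambda>n q. mode V (mode V a (int j) b) n (mode V d q (vacuum V))
           - mode V d q (mode V (mode V a (int j) b) n (vacuum V)))"
          using locality_finite_order unfolding finite_order_def by blast
      qed (rule vs.scale_right_diff_distrib)
      then have "finite_order (\<lambda>n q. \<Sum>j\<le>m. vscale V (of_nat (m choose j))
          (mode V (mode V a (int j) b) (n + (int m - int j)) (mode V d q (vacuum V))
           - mode V d q (mode V (mode V a (int j) b) (n + (int m - int j)) (vacuum V))))"
        by (intro finite_order_sum) auto
      then show ?thesis
        by (simp add: S_def mode_right sum_subtractf[symmetric] vs.scale_right_diff_distrib
            add_diff_eq add.commute)
    qed
    from finite_order_diff[OF commutator_local[of a "int m" b d "vacuum V"] this]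
    show "finite_order (\<lambda>n q. X n (mode V d q (vacuum V)) - mode V d q (X n (vacuum V)))"
      by (simp add: X_def mode_right algebra_simps)
  qed
  then show ?thesis unfolding X_def S_def by simp
qed

text \<open>The coefficient of \<open>w^0\<close> in \<open>(z - w)^N Y(a,z) Y(b,w)|0\<rangle> = (z - w)^N Y(b,w) Y(a,z)|0\<rangle>\<close>. As
\<open>Y(a,z)|0\<rangle> = e^(zT) a\<close>, this is a finite form of skew-symmetry.\<close>

lemma skew_symmetry_binomial:
  "\<exists>N0. \<forall>N\<ge>N0. \<forall>p. mode V a p b
     = (\<Sum>j\<le>N. vscale V ((-1) ^ j * of_nat (N choose j))
          (mode V b (int j - 1) (mode V a (p - int j) (vacuum V))))"
proof -
  let ?G = "\<lambda>m n. mode V a m (mode V b n (vacuum V)) - mode V b n (mode V a m (vacuum V))"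
  obtain N0 where N0: "(shift_diff ^^ N0) ?G = (\<lambda>m n. 0)"
    using locality_finite_order by blast
  have "mode V a p b = (\<Sum>j\<le>N. vscale V ((-1) ^ j * of_nat (N choose j))
          (mode V b (int j - 1) (mode V a (p - int j) (vacuum V))))" if "N \<ge> N0" for N p
  proof -
    have "(shift_diff ^^ N) ?G = (\<lambda>m n. 0)"
      using shift_diff_pow_mono[OF N0 that] .
    then have 0: "(shift_diff ^^ N) (\<lambda>m n. mode V a m (mode V b n (vacuum V))) (p - int N) (-1)
       = (shift_diff ^^ N) (\<lambda>m n. mode V b n (mode V a m (vacuum V))) (p - int N) (-1)"
      unfolding shift_diff_pow_diff fun_eq_iff by simp
    have "mode V a p b
       = (shift_diff ^^ N) (\<lambda>m n. mode V a m (mode V b n (vacuum V))) (p - int N) (-1)"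
      by (subst shift_diff_pow_edge)
        (auto simp: mode_vacuum_creation mode_vacuum_nonneg mode_right)
    then show ?thesis
      unfolding 0 by (simp add: shift_diff_pow_binomial)
  qed
  then show ?thesis by blast
qed

end

context vertex_algebra
begin

lemma commutator_mode_0:
  "mode V a 0 (mode V b n v) - mode V b n (mode V a 0 v) = mode V (mode V a 0 b) n v"
  using commutator_formula[of a 0 b n v] by simp

lemma commutator_mode_1:
  "mode V a 1 (mode V b n v) - mode V b n (mode V a 1 v)
     = mode V (mode V a 0 b) (n + 1) v + mode V (mode V a 1 b) n v"
  using commutator_formula[of a 1 b n v] by (simp add: add.commute)

lemma scale_two: "vscale V 2 x = x + x"
  using vs.scale_left_distrib[of 1 1 x] by simp

lemma subspace_closed:
  assumes "subvertex_algebra V A"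
  shows "0 \<in> A" and "vacuum V \<in> A" and "\<lbrakk>x \<in> A; y \<in> A\<rbrakk> \<Longrightarrow> x + y \<in> A"
    and "\<lbrakk>x \<in> A; y \<in> A\<rbrakk> \<Longrightarrow> x - y \<in> A" and "x \<in> A \<Longrightarrow> vscale V c x \<in> A"
    and "\<lbrakk>x \<in> A; y \<in> A\<rbrakk> \<Longrightarrow> mode V x n y \<in> A" and "x \<in> A \<Longrightarrow> transl V x \<in> A"
proof -
  have sub: "vs.subspace A" and vac: "vacuum V \<in> A"
    and mode: "\<lbrakk>x \<in> A; y \<in> A\<rbrakk> \<Longrightarrow> mode V x n y \<in> A" for x y n
    using assms unfolding subvertex_algebra_def by blast+
  show "0 \<in> A" "\<lbrakk>x \<in> A; y \<in> A\<rbrakk> \<Longrightarrow> x + y \<in> A" "\<lbrakk>x \<in> A; y \<in> A\<rbrakk> \<Longrightarrow> x - y \<in> A"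
    "x \<in> A \<Longrightarrow> vscale V c x \<in> A"
    using sub by (blast intro: vs.subspace_0 vs.subspace_add vs.subspace_diff vs.subspace_scale)+
  show "vacuum V \<in> A" by (rule vac)
  show "\<lbrakk>x \<in> A; y \<in> A\<rbrakk> \<Longrightarrow> mode V x n y \<in> A" by (rule mode)
  show "x \<in> A \<Longrightarrow> transl V x \<in> A"
    unfolding transl_conv_mode by (rule mode) (auto intro: vac)
qed

lemma transl_image_subspace:
  assumes "subvertex_algebra V A"
  shows "vs.subspace (transl V ` A)"
proof (rule vs.subspaceI)
  show "0 \<in> transl V ` A"
    using subspace_closed(1)[OF assms] transl_simps(4) by force
next
  fix x y assume "x \<in> transl V ` A" "y \<in> transl V ` A"
  then obtain x' y' where "x = transl V x'" "y = transl V y'" "x' \<in> A" "y' \<in> A" by blast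
  then show "x + y \<in> transl V ` A"
    using subspace_closed(3)[OF assms] by (metis image_eqI transl_simps(1))
next
  fix c x assume "x \<in> transl V ` A"
  then obtain x' where "x = transl V x'" "x' \<in> A" by blast
  then show "vscale V c x \<in> transl V ` A"
    using subspace_closed(5)[OF assms] by (metis image_eqI transl_simps(3))
qed

text \<open>Modulo \<open>T A\<close> one has \<open>b\<^sub>(\<^sub>n\<^sub>)Ty \<equiv> n b\<^sub>(\<^sub>n\<^sub>-\<^sub>1\<^sub>)y\<close>. Hence \<open>b\<^sub>(\<^sub>k\<^sub>+\<^sub>1\<^sub>)T^k a / k!\<close> is congruent to
\<open>(k + 1)! / k!\<close> times \<open>b\<^sub>(\<^sub>1\<^sub>)a\<close>.\<close>

lemma mode_vacuum_neg_cong: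
  assumes A: "subvertex_algebra V A" and a: "a \<in> A" and b: "b \<in> A"
  shows "mode V b (int k + 1) (mode V a (- 1 - int k) (vacuum V))
     - vscale V (of_nat (Suc k)) (mode V b 1 a) \<in> transl V ` A"
proof (induction k)
  case 0
  show ?case
    using vs.subspace_0[OF transl_image_subspace[OF A]] by (simp add: mode_vacuum_creation)
next
  case (Suc k)
  let ?c = "of_nat (Suc k) :: complex"
  let ?y = "mode V a (- 1 - int k) (vacuum V)"
  have c: "?c \<noteq> 0" by (rule of_nat_neq_0)
  define z where "z = mode V b (int (Suc k) + 1) ?y"
  have z: "z \<in> A" unfolding z_def by (intro subspace_closed[OF A] a b)
  have "mode V b (int (Suc k) + 1) (transl V ?y)
      = transl V z + vscale V (of_nat (Suc (Suc k))) (mode V b (int k + 1) ?y)"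
    using transl_mode[of b "int (Suc k) + 1" ?y] by (simp add: z_def algebra_simps)
  then have "mode V b (int (Suc k) + 1) (mode V a (- 1 - int (Suc k)) (vacuum V))
      - vscale V (of_nat (Suc (Suc k))) (mode V b 1 a)
    = vscale V (1 / ?c) (transl V z)
      + vscale V (of_nat (Suc (Suc k)) / ?c)
          (mode V b (int k + 1) ?y - vscale V ?c (mode V b 1 a))"
    unfolding vacuum_mode_neg[of a k]
    using c by (simp add: mode_right vs.scale_right_distrib vs.scale_right_diff_distrib del: of_nat_Suc)
  also have "\<dots> \<in> transl V ` A"
    by (intro vs.subspace_add vs.subspace_scale transl_image_subspace[OF A] Suc.IH)
      (use z in auto)
  finally show ?case .
qed

text \<open>Skew-symmetry modulo \<open>T A\<close>. In the finite form the summand with index \<open>j\<close> is congruent to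
\<open>(-1)^j (N choose j) (j - 1) b\<^sub>(\<^sub>1\<^sub>)a\<close> for \<open>j \<ge> 1\<close> and vanishes for \<open>j = 0\<close>. For \<open>N \<ge> 2\<close> the sum of
\<open>(-1)^j (N choose j) (j - 1)\<close> over all \<open>j \<ge> 0\<close> is zero, so without \<open>j = 0\<close> it is \<open>1\<close>.\<close>

lemma mode_1_symmetric:
  assumes A: "subvertex_algebra V A" and a: "a \<in> A" and b: "b \<in> A"
  shows "mode V a 1 b - mode V b 1 a \<in> transl V ` A"
proof -
  obtain N0 where N0: "\<And>N p. N \<ge> N0 \<Longrightarrow> mode V a p b
     = (\<Sum>j\<le>N. vscale V ((-1) ^ j * of_nat (N choose j))
          (mode V b (int j - 1) (mode V a (p - int j) (vacuum V))))"
    using skew_symmetry_binomial by blast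
  \<comment> \<open>Both alternating sums below vanish only from \<open>N = 2\<close> on.\<close>
  define N where "N = max N0 2"
  let ?s = "\<lambda>j. (-1) ^ j * of_nat (N choose j) :: complex"
  let ?e = "\<lambda>j. if j = 0 then 0 else of_nat j - 1 :: complex"
  have "mode V b (int j - 1) (mode V a (1 - int j) (vacuum V)) - vscale V (?e j) (mode V b 1 a)
      \<in> transl V ` A" for j
  proof (cases "j < 2")
    case True
    then have "j = 0 \<or> j = 1" by auto
    then show ?thesis
      using vs.subspace_0[OF transl_image_subspace[OF A]]
      by (auto simp: mode_vacuum_nonneg mode_right)
  next
    case False
    then obtain k where j: "j = Suc (Suc k)"
      by (metis add_2_eq_Suc le_add_diff_inverse not_less)
    then show ?thesis
      using mode_vacuum_neg_cong[OF A a b, of k] by (simp add: algebra_simps)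
  qed
  then have "(\<Sum>j\<le>N. vscale V (?s j) (mode V b (int j - 1) (mode V a (1 - int j) (vacuum V))
      - vscale V (?e j) (mode V b 1 a))) \<in> transl V ` A"
    by (intro vs.subspace_sum vs.subspace_scale transl_image_subspace[OF A])
  also have "(\<Sum>j\<le>N. vscale V (?s j) (mode V b (int j - 1) (mode V a (1 - int j) (vacuum V))
      - vscale V (?e j) (mode V b 1 a)))
    = mode V a 1 b - vscale V (\<Sum>j\<le>N. ?s j * ?e j) (mode V b 1 a)"
    using N0[of N 1]
    by (simp add: N_def vs.scale_right_diff_distrib sum_subtractf vs.scale_sum_left)
  also have "(\<Sum>j\<le>N. ?s j * ?e j) = 1"
  proof -
    have "(\<Sum>j\<le>N. ?s j * ?e j)
        = (\<Sum>j\<le>N. (-1) ^ j * of_nat j * of_nat (N choose j) - ?s j + (if j = 0 then 1 else 0))"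
      by (rule sum.cong) (auto simp: algebra_simps)
    also have "\<dots> = (\<Sum>j\<le>N. (-1) ^ j * of_nat j * of_nat (N choose j)) - (\<Sum>j\<le>N. ?s j)
        + (\<Sum>j\<le>N. if j = 0 then 1 else 0)"
      by (simp add: sum.distrib sum_subtractf)
    also have "\<dots> = 1"
    proof -
      have "N > 0" and "N \<noteq> 1" by (simp_all add: N_def max_def)
      then show ?thesis
        using choose_alternating_sum[of N, where 'a = complex]
          choose_alternating_linear_sum[of N, where 'a = complex] by simp
    qed
    finally show ?thesis .
  qed
  finally show ?thesis by simp
qed

end

section \<open>Grading\<close>

context graded_conformal_vertex_algebra
begin

text \<open>As \<open>T = \<omega>\<^sub>(\<^sub>0\<^sub>)\<close>, the commutator formula turns \<open>[T, a\<^sub>(\<^sub>n\<^sub>)]\<close> into \<open>(Ta)\<^sub>(\<^sub>n\<^sub>)\<close>.\<close>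

lemma mode_transl: "mode V (transl V a) n b = vscale V (- of_int n) (mode V a (n - 1) b)"
proof -
  have T: "transl V v = mode V (conf V) 0 v" for v
    using virasoro_minus_one[of v] by (simp add: virasoro_mode_def)
  show ?thesis
    using commutator_mode_0[of "conf V" a n b] transl_mode[of a n b] by (simp add: T)
qed

text \<open>If \<open>Te = 0\<close> then \<open>0 = (Te)\<^sub>(\<^sub>n\<^sub>+\<^sub>1\<^sub>) = -(n + 1) e\<^sub>(\<^sub>n\<^sub>)\<close>, so \<open>Y(e,z) = e\<^sub>(\<^sub>-\<^sub>1\<^sub>)\<close> is constant. By
skew-symmetry \<open>Y(x,z)e\<close> then has no negative powers of \<open>z\<close>.\<close>

lemma mode_transl_kernel:
  assumes "transl V e = 0"
  shows "n \<noteq> -1 \<Longrightarrow> mode V e n x = 0" and "p \<ge> 0 \<Longrightarrow> mode V x p e = 0"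
proof -
  have left: "mode V e n x = 0" if "n \<noteq> -1" for n x
  proof -
    have "vscale V (- of_int (n + 1)) (mode V e n x) = 0"
      using mode_transl[of e "n + 1" x] by (simp add: assms mode_left)
    moreover have "(- of_int (n + 1) :: complex) \<noteq> 0"
      using that by (metis add_eq_0_iff neg_equal_0_iff_equal of_int_eq_0_iff add.commute)
    ultimately show ?thesis by (metis vs.scale_eq_0_iff)
  qed
  then show "n \<noteq> -1 \<Longrightarrow> mode V e n x = 0" .
  assume p: "p \<ge> 0"
  obtain N where "mode V x p e = (\<Sum>j\<le>N. vscale V ((-1) ^ j * of_nat (N choose j))
          (mode V e (int j - 1) (mode V x (p - int j) (vacuum V))))"
    using skew_symmetry_binomial[of x e] by blast
  also have "\<dots> = 0"
  proof (rule sum.neutral, rule ballI)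
    fix j
    show "vscale V ((-1) ^ j * of_nat (N choose j))
          (mode V e (int j - 1) (mode V x (p - int j) (vacuum V))) = 0"
      using p by (cases "j = 0") (simp_all add: left mode_vacuum_nonneg mode_right)
  qed
  finally show "mode V x p e = 0" .
qed

lemma component_decomposition: "homogeneous_decomposition V v (component V v)"
  unfolding component_def by (rule theI'[OF homogeneous_decomposition])

lemma component_grade: "component V v n \<in> grade V n"
  and finite_component: "finite {n. component V v n \<noteq> 0}"
  and sum_component: "(\<Sum>n | component V v n \<noteq> 0. component V v n) = v"
  using component_decomposition[of v] unfolding homogeneous_decomposition_def by auto

lemma component_eqI:
  assumes "\<And>n. f n \<in> grade V n" and "finite S" and "\<And>n. n \<notin> S \<Longrightarrow> f n = 0"
    and "v = (\<Sum>n\<in>S. f n)"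
  shows "component V v = f"
proof -
  have sub: "{n. f n \<noteq> 0} \<subseteq> S" using assms(3) by auto
  have "homogeneous_decomposition V v f"
    unfolding homogeneous_decomposition_def
    using assms sub by (auto intro: finite_subset sum.mono_neutral_right)
  then show ?thesis
    using homogeneous_decomposition[of v] component_decomposition[of v] by blast
qed

lemma sum_component_superset:
  "\<lbrakk>finite S; {n. component V v n \<noteq> 0} \<subseteq> S\<rbrakk> \<Longrightarrow> v = (\<Sum>n\<in>S. component V v n)"
  by (subst sum_component[of v, symmetric]) (rule sum.mono_neutral_left, auto)

lemma component_add: "component V (x + y) = (\<lambda>n. component V x n + component V y n)"
proof (rule component_eqI)
  let ?S = "{n. component V x n \<noteq> 0} \<union> {n. component V y n \<noteq> 0}"
  show "finite ?S" by (simp add: finite_component)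
  then show "x + y = (\<Sum>n\<in>?S. component V x n + component V y n)"
    unfolding sum.distrib using sum_component_superset by (metis Un_upper1 Un_upper2)
qed (auto intro!: vs.subspace_add grade_subspace component_grade)

lemma component_scale: "component V (vscale V c x) = (\<lambda>n. vscale V c (component V x n))"
proof (rule component_eqI)
  let ?S = "{n. component V x n \<noteq> 0}"
  show "finite ?S" by (simp add: finite_component)
  show "vscale V c x = (\<Sum>n\<in>?S. vscale V c (component V x n))"
    unfolding vs.scale_sum_right[symmetric] sum_component ..
qed (auto intro!: vs.subspace_scale grade_subspace component_grade)

lemma component_zero: "component V 0 n = 0"
  using component_scale[of 0 0] by (simp add: fun_eq_iff)

lemma component_diff: "component V (x - y) n = component V x n - component V y n"
proof -
  have "component V (x - y) n + component V y n = component V x n"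
    using component_add[of "x - y" y] by (simp add: fun_eq_iff)
  then show ?thesis by (simp add: algebra_simps)
qed

lemma component_sum: "component V (\<Sum>x\<in>S. f x) n = (\<Sum>x\<in>S. component V (f x) n)"
  by (induction S rule: infinite_finite_induct) (simp_all add: component_zero component_add)

lemma component_homogeneous:
  assumes "v \<in> grade V p"
  shows "component V v n = (if n = p then v else 0)"
proof -
  have "component V v = (\<lambda>n. if n = p then v else 0)"
    by (rule component_eqI[where S = "{p}"])
      (use assms vs.subspace_0[OF grade_subspace] in auto)
  then show ?thesis by simp
qed

text \<open>The inclusion \<open>ker T \<subseteq> V\<^sub>0\<close>: for \<open>Te = 0\<close> one has \<open>L\<^sub>0e = \<omega>\<^sub>(\<^sub>1\<^sub>)e = 0\<close>, while \<open>L\<^sub>0\<close> multiplies the component of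
degree \<open>n\<close> by \<open>n\<close>.\<close>

lemma transl_kernel_degree_zero:
  assumes "transl V e = 0" and "n > 0"
  shows "component V e n = 0"
proof -
  let ?S = "{n. component V e n \<noteq> 0}"
  have "component V (\<Sum>n\<in>?S. vscale V (of_nat n) (component V e n))
      = (\<lambda>n. vscale V (of_nat n) (component V e n))"
    by (rule component_eqI[where S = ?S])
      (auto simp: finite_component intro!: vs.subspace_scale grade_subspace component_grade)
  moreover have "(\<Sum>n\<in>?S. vscale V (of_nat n) (component V e n)) = mode V (conf V) 1 e"
  proof -
    have "(\<Sum>n\<in>?S. vscale V (of_nat n) (component V e n))
        = (\<Sum>n\<in>?S. mode V (conf V) 1 (component V e n))"
      by (rule sum.cong)
        (use virasoro_zero[OF component_grade] in \<open>simp_all add: virasoro_mode_def\<close>)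
    then show ?thesis
      unfolding mode_right(6)[symmetric] by (simp only: sum_component)
  qed
  moreover have "mode V (conf V) 1 e = 0"
    by (rule mode_transl_kernel(2)[OF assms(1)]) simp
  ultimately have "vscale V (of_nat n) (component V e n) = 0"
    by (metis component_zero)
  then show ?thesis using assms(2) by simp
qed

lemma transl_injective:
  assumes "transl V x = transl V y" and "component V x 0 = component V y 0"
  shows "x = y"
proof -
  have "component V (x - y) n = 0" for n
    using transl_kernel_degree_zero[of "x - y" n] assms
    by (cases "n = 0") (simp_all add: transl_simps component_diff)
  then have "x - y = 0"
    using sum_component[of "x - y"] by simp
  then show ?thesis by simp
qed

lemma pos_proj_conv_component: "pos_proj V v = v - component V v 0"
proof -
  let ?S = "{n. component V v n \<noteq> 0}"
  have "v = (\<Sum>n\<in>insert 0 ?S. component V v n)"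
    by (rule sum_component_superset) (auto simp: finite_component)
  also have "\<dots> = component V v 0 + (\<Sum>n\<in>?S - {0}. component V v n)"
    by (rule sum.insert_remove) (rule finite_component)
  also have "?S - {0} = {n. n > 0 \<and> component V v n \<noteq> 0}" by auto
  finally show ?thesis unfolding pos_proj_def by (simp add: algebra_simps)
qed

end

section \<open>Dijkgraaf's condition\<close>

locale dijkgraaf_subalgebra = graded_conformal_vertex_algebra V
  for V :: "('v::ab_group_add, 'm) conformal_vertex_alg_scheme" +
  fixes A :: "'v set"
  assumes subalgebra: "subvertex_algebra V A"
    and graded: "graded_subset V A"
    and dijkgraaf: "dijkgraaf V A"
begin

lemmas closed = subspace_closed[OF subalgebra]

lemma component_closed: "x \<in> A \<Longrightarrow> component V x n \<in> A"
  using graded unfolding graded_subset_def by blast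

lemma degree_one: "\<lbrakk>x \<in> A; x \<in> grade V 1\<rbrakk> \<Longrightarrow> x = 0"
  using dijkgraaf unfolding dijkgraaf_def by blast

lemma degree_zero_transl: "\<lbrakk>x \<in> A; x \<in> grade V 0\<rbrakk> \<Longrightarrow> transl V x = 0"
  using transl_grade[of x 0] by (intro degree_one closed) auto

lemma mode_0_in_transl: "\<lbrakk>a \<in> A; b \<in> A\<rbrakk> \<Longrightarrow> mode V a 0 b \<in> transl V ` A"
  using dijkgraaf unfolding dijkgraaf_def by blast

text \<open>Passing to the positive part of a preimage does not change its image under \<open>T\<close>, because \<open>T\<close> maps
\<open>A \<inter> V\<^sub>0\<close> into \<open>A \<inter> V\<^sub>1 = 0\<close>.\<close>

lemma T_inv_props:
  assumes "x \<in> transl V ` A"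
  shows "T_inv V A x \<in> A" and "transl V (T_inv V A x) = x" and "component V (T_inv V A x) 0 = 0"
proof -
  define c where "c = (SOME c. c \<in> A \<and> transl V c = x)"
  have c: "c \<in> A" "transl V c = x"
    unfolding c_def using someI_ex[of "\<lambda>c. c \<in> A \<and> transl V c = x"] assms by auto
  have T_inv: "T_inv V A x = c - component V c 0"
    unfolding T_inv_def c_def pos_proj_conv_component ..
  show "T_inv V A x \<in> A" unfolding T_inv by (intro closed component_closed c)
  show "transl V (T_inv V A x) = x"
    unfolding T_inv using degree_zero_transl[OF component_closed component_grade] c
    by (simp add: transl_simps)
  show "component V (T_inv V A x) 0 = 0"
    unfolding T_inv by (simp add: component_diff component_homogeneous[OF component_grade])
qed

lemma B_closed: "\<lbrakk>a \<in> A; b \<in> A\<rbrakk> \<Longrightarrow> B_prod V A a b \<in> A"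
  and transl_B: "\<lbrakk>a \<in> A; b \<in> A\<rbrakk> \<Longrightarrow> transl V (B_prod V A a b) = mode V a 0 b"
  and component_B: "\<lbrakk>a \<in> A; b \<in> A\<rbrakk> \<Longrightarrow> component V (B_prod V A a b) 0 = 0"
  unfolding B_prod_def using T_inv_props[OF mode_0_in_transl] by auto

lemma C_closed: "\<lbrakk>a \<in> A; b \<in> A\<rbrakk> \<Longrightarrow> C_prod V A a b \<in> A"
  unfolding C_prod_def by (intro closed B_closed)

text \<open>Equations between values of \<open>B\<close> follow from their images under \<open>T\<close>, since these values have no
component of degree \<open>0\<close>.\<close>

lemma B_bilinear:
  assumes "a \<in> A" "b \<in> A" "c \<in> A"
  shows "B_prod V A (a + b) c = B_prod V A a c + B_prod V A b c"
    and "B_prod V A c (a + b) = B_prod V A c a + B_prod V A c b"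
    and "B_prod V A (vscale V s a) c = vscale V s (B_prod V A a c)"
    and "B_prod V A c (vscale V s a) = vscale V s (B_prod V A c a)"
    and "B_prod V A (a - b) c = B_prod V A a c - B_prod V A b c"
    and "B_prod V A c (a - b) = B_prod V A c a - B_prod V A c b"
proof -
  note simps = assms closed transl_B component_B transl_simps mode_left mode_right
    component_add component_scale component_diff
  show "B_prod V A (a + b) c = B_prod V A a c + B_prod V A b c"
    by (rule transl_injective) (simp_all add: simps)
  show "B_prod V A c (a + b) = B_prod V A c a + B_prod V A c b"
    by (rule transl_injective) (simp_all add: simps)
  show "B_prod V A (vscale V s a) c = vscale V s (B_prod V A a c)"
    by (rule transl_injective) (simp_all add: simps)
  show "B_prod V A c (vscale V s a) = vscale V s (B_prod V A c a)"
    by (rule transl_injective) (simp_all add: simps)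
  show "B_prod V A (a - b) c = B_prod V A a c - B_prod V A b c"
    by (rule transl_injective) (simp_all add: simps)
  show "B_prod V A c (a - b) = B_prod V A c a - B_prod V A c b"
    by (rule transl_injective) (simp_all add: simps)
qed

lemma C_bilinear:
  assumes "a \<in> A" "b \<in> A" "c \<in> A"
  shows "C_prod V A (a + b) c = C_prod V A a c + C_prod V A b c"
    and "C_prod V A c (a + b) = C_prod V A c a + C_prod V A c b"
    and "C_prod V A (vscale V s a) c = vscale V s (C_prod V A a c)"
    and "C_prod V A c (vscale V s a) = vscale V s (C_prod V A c a)"
  by (simp_all add: C_prod_def B_bilinear[OF assms] mode_left mode_right vs.scale_right_diff_distrib)

lemma mode_B:
  assumes "a \<in> A" "b \<in> A"
  shows "mode V (mode V a 0 b) n c = vscale V (- of_int n) (mode V (B_prod V A a b) (n - 1) c)"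
  using mode_transl[of "B_prod V A a b"] transl_B assms by simp

text \<open>Here \<open>[a\<^sub>(\<^sub>0\<^sub>), b\<^sub>(\<^sub>0\<^sub>)] = (a\<^sub>(\<^sub>0\<^sub>)b)\<^sub>(\<^sub>0\<^sub>) = (T B(a, b))\<^sub>(\<^sub>0\<^sub>) = 0\<close>, and \<open>T\<close> commutes with \<open>a\<^sub>(\<^sub>0\<^sub>)\<close>. So \<open>T\<close>
applied to the first equation, or \<open>T\<^sup>2\<close> to the second, gives \<open>a\<^sub>(\<^sub>0\<^sub>)b\<^sub>(\<^sub>0\<^sub>)c = b\<^sub>(\<^sub>0\<^sub>)a\<^sub>(\<^sub>0\<^sub>)c\<close>.\<close>

lemma B_commute:
  assumes "a \<in> A" "b \<in> A" "c \<in> A"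
  shows "mode V a 0 (B_prod V A b c) = mode V b 0 (B_prod V A a c)"
    and "B_prod V A a (B_prod V A b c) = B_prod V A b (B_prod V A a c)"
proof -
  have transl_mode_0: "transl V (mode V x 0 y) = mode V x 0 (transl V y)" for x y
    using transl_mode[of x 0 y] by simp
  have "mode V a 0 (mode V b 0 c) = mode V b 0 (mode V a 0 c)"
    using commutator_mode_0[of a b 0 c] assms by (simp add: mode_B)
  then have T: "transl V (mode V a 0 (B_prod V A b c)) = transl V (mode V b 0 (B_prod V A a c))"
    using assms by (simp add: transl_mode_0 transl_B)
  have "component V (transl V x) 0 = 0" for x
  proof -
    have "component V (transl V x) 0
        = (\<Sum>n | component V x n \<noteq> 0. component V (transl V (component V x n)) 0)"
      by (metis component_sum sum_component transl_simps(6))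
    also have "\<dots> = 0"
      by (rule sum.neutral) (simp add: component_homogeneous[OF transl_grade[OF component_grade]])
    finally show ?thesis .
  qed
  then have "component V (mode V x 0 (B_prod V A y z)) 0 = 0" if "x \<in> A" "y \<in> A" "z \<in> A" for x y z
    using mode_0_in_transl[of x "B_prod V A y z"] B_closed that by auto
  then show eq: "mode V a 0 (B_prod V A b c) = mode V b 0 (B_prod V A a c)"
    using transl_injective[OF T] assms by simp
  show "B_prod V A a (B_prod V A b c) = B_prod V A b (B_prod V A a c)"
    by (rule transl_injective) (use assms eq in \<open>simp_all add: transl_B component_B B_closed\<close>)
qed

text \<open>For homogeneous factors of degrees \<open>p\<close> and \<open>q > 0\<close>, degree \<open>p + q - 2 = 0\<close> leaves two cases. If
\<open>p = 1\<close>, the left factor is in \<open>A \<inter> V\<^sub>1 = 0\<close>; if \<open>p = 0\<close>, it is in \<open>ker T\<close> and its mode \<open>1\<close> is zero.\<close>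

lemma component_mode_1:
  assumes a: "a \<in> A" and d: "d \<in> A" and "component V d 0 = 0"
  shows "component V (mode V a 1 d) 0 = 0"
proof -
  have homogeneous: "component V (mode V x 1 y) 0 = 0"
    if x: "x \<in> A" "x \<in> grade V p" and y: "y \<in> grade V q" and "q > 0" for x y p q
  proof (cases "p + q = 2")
    case True
    then have "p = 0 \<or> p = 1" using \<open>q > 0\<close> by auto
    then have "mode V x 1 y = 0"
      using degree_one[of x] mode_transl_kernel(1)[OF degree_zero_transl] x
      by (auto simp: mode_left)
    then show ?thesis by (simp add: component_zero)
  next
    case False
    then show ?thesis
      using grade_mode[OF x(2) y, of 1]
      by (auto simp: component_zero component_homogeneous split: if_splits)
  qed
  let ?S = "{n. component V a n \<noteq> 0}" and ?R = "{n. component V d n \<noteq> 0}"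
  have "mode V a 1 d = (\<Sum>p\<in>?S. \<Sum>q\<in>?R. mode V (component V a p) 1 (component V d q))"
    unfolding mode_right(6)[symmetric] mode_left(6)[symmetric] sum_component ..
  then have "component V (mode V a 1 d) 0
      = (\<Sum>p\<in>?S. \<Sum>q\<in>?R. component V (mode V (component V a p) 1 (component V d q)) 0)"
    by (simp add: component_sum)
  also have "\<dots> = 0"
  proof (intro sum.neutral ballI)
    fix p q assume "q \<in> ?R"
    then have "q > 0" using assms(3) by (metis gr0I mem_Collect_eq)
    then show "component V (mode V (component V a p) 1 (component V d q)) 0 = 0"
      by (rule homogeneous[OF component_closed[OF a] component_grade component_grade])
  qed
  finally show ?thesis .
qed

text \<open>As \<open>[a\<^sub>(\<^sub>1\<^sub>), b\<^sub>(\<^sub>0\<^sub>)] = C(a, b)\<^sub>(\<^sub>0\<^sub>)\<close>, both sides have the same image under \<open>T\<close>: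
\<open>T a\<^sub>(\<^sub>1\<^sub>)B(b, c) = a\<^sub>(\<^sub>1\<^sub>)b\<^sub>(\<^sub>0\<^sub>)c - a\<^sub>(\<^sub>0\<^sub>)B(b, c)\<close>, and the last term equals \<open>b\<^sub>(\<^sub>0\<^sub>)B(a, c)\<close>.\<close>

lemma mode_1_B:
  assumes a: "a \<in> A" and b: "b \<in> A" and c: "c \<in> A"
  shows "mode V a 1 (B_prod V A b c) = B_prod V A b (C_prod V A a c) + B_prod V A (C_prod V A a b) c"
proof (rule transl_injective)
  note mem = a b c B_closed C_closed
  show "component V (mode V a 1 (B_prod V A b c)) 0
    = component V (B_prod V A b (C_prod V A a c) + B_prod V A (C_prod V A a b) c) 0"
    by (simp add: mem component_mode_1 component_add component_B)
  have "transl V (mode V a 1 (B_prod V A b c))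
      = mode V a 1 (mode V b 0 c) - mode V a 0 (B_prod V A b c)"
    using transl_mode[of a 1 "B_prod V A b c"] by (simp add: mem transl_B algebra_simps)
  also have "mode V a 1 (mode V b 0 c) = mode V b 0 (mode V a 1 c)
      - mode V (B_prod V A a b) 0 c + mode V (mode V a 1 b) 0 c"
    using commutator_mode_1[of a b 0 c] by (simp add: mem mode_B algebra_simps)
  also have "mode V a 0 (B_prod V A b c) = mode V b 0 (B_prod V A a c)"
    by (rule B_commute) fact+
  finally show "transl V (mode V a 1 (B_prod V A b c))
      = transl V (B_prod V A b (C_prod V A a c) + B_prod V A (C_prod V A a b) c)"
    by (simp add: mem transl_simps transl_B C_prod_def closed mode_left mode_right algebra_simps)
qed

lemma C_B_identity:
  assumes "a \<in> A" "b \<in> A" "c \<in> A"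
  shows "C_prod V A a (B_prod V A b c) - B_prod V A b (C_prod V A a c)
      + B_prod V A a (B_prod V A b c) = B_prod V A (C_prod V A a b) c"
  using mode_1_B[OF assms] by (simp add: C_prod_def[of V A a "B_prod V A b c"] algebra_simps)

text \<open>In the expansion all iterated products \<open>B\<close> cancel by \<open>mode_1_B\<close>, which leaves
\<open>X = (b\<^sub>(\<^sub>1\<^sub>)a - B(a, b) - B(b, a))\<^sub>(\<^sub>1\<^sub>)c\<close>. The two orders of the commutator \<open>[a\<^sub>(\<^sub>1\<^sub>), b\<^sub>(\<^sub>1\<^sub>)]\<close> then
eliminate \<open>B\<close>: \<open>2 X = (b\<^sub>(\<^sub>1\<^sub>)a - a\<^sub>(\<^sub>1\<^sub>)b)\<^sub>(\<^sub>1\<^sub>)c\<close>.\<close>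

lemma C_C_identity:
  assumes a: "a \<in> A" and b: "b \<in> A" and c: "c \<in> A"
  shows "C_prod V A a (C_prod V A b c) - C_prod V A b (C_prod V A a c)
      - (C_prod V A (C_prod V A a b) c - C_prod V A (C_prod V A b a) c) \<in> transl V ` A"
    (is "?X \<in> _")
proof -
  note mem = a b c B_closed C_closed
  let ?B = "B_prod V A"
  have comm: "mode V x 1 (mode V y 1 c) - mode V y 1 (mode V x 1 c)
      = - (mode V (?B x y) 1 c + mode V (?B x y) 1 c) + mode V (mode V x 1 y) 1 c" if "x \<in> A" "y \<in> A" for x y
    using commutator_mode_1[of x y 1 c] that by (simp add: mode_B scale_two vs.scale_minus_left)
  have C_C: "C_prod V A x (C_prod V A y c)
      = mode V x 1 (mode V y 1 c) - mode V x 1 (?B y c) - ?B x (mode V y 1 c) + ?B x (?B y c)"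
    if "x \<in> A" "y \<in> A" for x y
    using that by (simp add: C_prod_def mem closed B_bilinear mode_right)
  have C_C_left: "C_prod V A (C_prod V A x y) c
      = mode V (mode V x 1 y) 1 c - mode V (?B x y) 1 c - ?B (mode V x 1 y) c + ?B (?B x y) c"
    if "x \<in> A" "y \<in> A" for x y
    using that by (simp add: C_prod_def mem closed B_bilinear mode_left)
  have mode_1_B_expanded: "mode V x 1 (?B y c)
      = ?B y (mode V x 1 c) - ?B y (?B x c) + ?B (mode V x 1 y) c - ?B (?B x y) c"
    if "x \<in> A" "y \<in> A" for x y
    using that mode_1_B[OF that c] by (simp add: C_prod_def mem closed B_bilinear)
  have ab: "mode V a 1 (mode V b 1 c) = mode V b 1 (mode V a 1 c)
      - mode V (?B a b) 1 c - mode V (?B a b) 1 c + mode V (mode V a 1 b) 1 c"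
    using comm[OF a b] by (simp add: algebra_simps)
  have ba: "mode V b 1 (mode V a 1 c) = mode V a 1 (mode V b 1 c)
      - mode V (?B b a) 1 c - mode V (?B b a) 1 c + mode V (mode V b 1 a) 1 c"
    using comm[OF b a] by (simp add: algebra_simps)
  have X: "?X = mode V (mode V b 1 a) 1 c - mode V (?B a b) 1 c - mode V (?B b a) 1 c"
    unfolding C_C[OF a b] C_C[OF b a] C_C_left[OF a b] C_C_left[OF b a] mode_1_B_expanded[OF a b] mode_1_B_expanded[OF b a]
      ab B_commute(2)[OF a b c]
    by (simp add: algebra_simps)
  have "?X + ?X = mode V (mode V b 1 a) 1 c - mode V (mode V a 1 b) 1 c"
    using ab ba unfolding X by (simp add: algebra_simps)
  then have "vscale V 2 ?X = mode V (mode V b 1 a - mode V a 1 b) 1 c"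
    by (simp only: scale_two mode_left)
  also obtain d where d: "d \<in> A" "mode V b 1 a - mode V a 1 b = transl V d"
    using mode_1_symmetric[OF subalgebra b a] by blast
  note d(2)
  also have "mode V (transl V d) 1 c = vscale V (-1) (mode V d 0 c)"
    by (simp add: mode_transl)
  finally have "?X = vscale V (1/2) (vscale V (-1) (mode V d 0 c))"
    using vs.scale_scale[of "1/2" 2 ?X] by simp
  also have "\<dots> \<in> transl V ` A"
    by (intro vs.subspace_scale transl_image_subspace subalgebra mode_0_in_transl d c)
  finally show ?thesis .
qed

end

section \<open>Operators on tensor powers\<close>

lemma formal_map_superset:
  assumes "finite S" and "Poly_Mapping.keys p \<subseteq> S"
  shows "formal_map \<phi> p
    = (\<Sum>t\<in>S. Poly_Mapping.single (\<phi> t) (Poly_Mapping.lookup p t))"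
  unfolding formal_map_def
  by (rule sum.mono_neutral_left) (use assms in \<open>auto simp: in_keys_iff\<close>)

lemma formal_map_linear:
  fixes \<phi> :: "'x \<Rightarrow> 'x"
  shows "Vector_Spaces.linear formal_scale formal_scale (formal_map \<phi>)"
proof -
  have add: "formal_map \<phi> (p + q) = formal_map \<phi> p + formal_map \<phi> q" for p q
  proof -
    let ?S = "Poly_Mapping.keys p \<union> Poly_Mapping.keys q"
    have "Poly_Mapping.keys (p + q) \<subseteq> ?S" by (rule keys_add)
    then show ?thesis
      using formal_map_superset[of ?S]
      by (simp add: lookup_add single_add sum.distrib)
  qed
  have "formal_map \<phi> (formal_scale c p) = formal_scale c (formal_map \<phi> p)" for c p
  proof -
    have "formal_scale c (Poly_Mapping.single t d) = Poly_Mapping.single t (c * d)"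
      for t :: 'x and d
      by (rule poly_mapping_eqI) (simp add: lookup_single when_def)
    moreover have "Poly_Mapping.keys (formal_scale c p) \<subseteq> Poly_Mapping.keys p"
      by (auto simp: in_keys_iff)
    ultimately show ?thesis
      using formal_map_superset[of "Poly_Mapping.keys p"]
      by (simp add: formal.scale_sum_right)
  qed
  with add show ?thesis
    unfolding Vector_Spaces.linear_iff using formal.vector_space_axioms by blast
qed

lemma formal_map_single: "formal_map \<phi> (Poly_Mapping.single t 1) = Poly_Mapping.single (\<phi> t) 1"
  by (simp add: formal_map_def)

lemma single_formal_sums: "(\<forall>l. t l \<in> A) \<Longrightarrow> Poly_Mapping.single t 1 \<in> formal_sums A"
  by (simp add: formal_sums_def)

lemma formal_sums_diff: "p \<in> formal_sums A \<Longrightarrow> q \<in> formal_sums A \<Longrightarrow> p - q \<in> formal_sums A"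
  unfolding formal_sums_def using keys_diff[of p q] by blast

lemma formal_sums_add: "p \<in> formal_sums A \<Longrightarrow> q \<in> formal_sums A \<Longrightarrow> p + q \<in> formal_sums A"
  unfolding formal_sums_def using keys_add[of p q] by blast

text \<open>As a function of one entry \<open>t l\<close>, the tuple \<open>\<phi> t\<close> changes in a single slot \<open>l'\<close>, linearly. The slot
may be another one: a contraction of factors \<open>i\<close> and \<open>j\<close> puts the product into slot \<open>j\<close>, so there
\<open>l' = j\<close> for \<open>l = i\<close>. Such a map sends each multilinearity relation to a multilinearity relation, so
it induces an operator on the tensor power.\<close>

definition slotwise_linear ::
    "('v::ab_group_add, 'm) vertex_alg_scheme \<Rightarrow> 'v set \<Rightarrow> (('n \<Rightarrow> 'v) \<Rightarrow> ('n \<Rightarrow> 'v)) \<Rightarrow> bool" where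
  "slotwise_linear V A \<phi> \<longleftrightarrow>
     (\<forall>t l. (\<forall>m. t m \<in> A) \<longrightarrow>
       (\<exists>u l' g. (\<forall>m. u m \<in> A) \<and> (\<forall>x\<in>A. g x \<in> A \<and> \<phi> (t(l := x)) = u(l' := g x))
          \<and> (\<forall>x\<in>A. \<forall>y\<in>A. g (x + y) = g x + g y)
          \<and> (\<forall>c. \<forall>x\<in>A. g (vscale V c x) = vscale V c (g x))))"

lemma slotwise_linearE:
  assumes "slotwise_linear V A \<phi>" and "\<forall>m. t m \<in> A"
  obtains u l' g where "\<forall>m. u m \<in> A" and "\<And>x. x \<in> A \<Longrightarrow> g x \<in> A"
    and "\<And>x. x \<in> A \<Longrightarrow> \<phi> (t(l := x)) = u(l' := g x)"
    and "\<And>x y. \<lbrakk>x \<in> A; y \<in> A\<rbrakk> \<Longrightarrow> g (x + y) = g x + g y"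
    and "\<And>c x. x \<in> A \<Longrightarrow> g (vscale V c x) = vscale V c (g x)"
  using mp[OF spec[where x = l, OF spec[where x = t, OF assms(1)[unfolded slotwise_linear_def]]]
      assms(2)]
  by blast

lemma slotwise_linear_preserves:
  assumes "slotwise_linear V A \<phi>" and "\<forall>l. t l \<in> A"
  shows "\<phi> t l \<in> A"
proof -
  obtain u l' g where u: "\<forall>m. u m \<in> A" and g: "\<And>x. x \<in> A \<Longrightarrow> g x \<in> A"
      "\<And>x. x \<in> A \<Longrightarrow> \<phi> (t(l := x)) = u(l' := g x)"
    by (rule slotwise_linearE[OF assms, of l]) blast
  have "\<phi> (t(l := t l)) l \<in> A" using u g(1)[of "t l"] g(2)[of "t l"] assms(2) by (cases "l = l'") simp_all
  then show ?thesis by simp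
qed

context vertex_algebra
begin

lemma formal_map_span_relations:
  assumes A: "subvertex_algebra V A" and \<phi>: "slotwise_linear V A \<phi>"
    and p: "p \<in> formal.span (multilinear_relations V A)"
  shows "formal_map \<phi> p \<in> formal.span (multilinear_relations V A)"
proof -
  interpret f: Vector_Spaces.linear formal_scale formal_scale "formal_map \<phi>"
    by (rule formal_map_linear)
  have "formal_map \<phi> r \<in> multilinear_relations V A" if r: "r \<in> multilinear_relations V A" for r
    using r unfolding multilinear_relations_def
  proof (elim UnE)
    assume "r \<in> {Poly_Mapping.single (t(l := x + y)) 1
        - Poly_Mapping.single (t(l := x)) 1 - Poly_Mapping.single (t(l := y)) 1
      | t l x y. (\<forall>m. t m \<in> A) \<and> x \<in> A \<and> y \<in> A}"
    then obtain t l x y where t: "\<forall>m. t m \<in> A" and x: "x \<in> A" and y: "y \<in> A"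
      and r: "r = Poly_Mapping.single (t(l := x + y)) 1
        - Poly_Mapping.single (t(l := x)) 1 - Poly_Mapping.single (t(l := y)) 1" by blast
    obtain u l' g where u: "\<forall>m. u m \<in> A" and g: "\<And>x. x \<in> A \<Longrightarrow> g x \<in> A"
      "\<And>x. x \<in> A \<Longrightarrow> \<phi> (t(l := x)) = u(l' := g x)"
      "\<And>x y. \<lbrakk>x \<in> A; y \<in> A\<rbrakk> \<Longrightarrow> g (x + y) = g x + g y"
      by (rule slotwise_linearE[OF \<phi> t, of l]) blast
    have "formal_map \<phi> r = Poly_Mapping.single (u(l' := g x + g y)) 1
        - Poly_Mapping.single (u(l' := g x)) 1 - Poly_Mapping.single (u(l' := g y)) 1"
      unfolding r f.diff formal_map_single by (simp add: g x y subspace_closed(3)[OF A])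
    with u g(1)[OF x] g(1)[OF y] show "formal_map \<phi> r \<in> {Poly_Mapping.single (t(l := x + y)) 1
        - Poly_Mapping.single (t(l := x)) 1 - Poly_Mapping.single (t(l := y)) 1
      | t l x y. (\<forall>m. t m \<in> A) \<and> x \<in> A \<and> y \<in> A} \<union>
     {Poly_Mapping.single (t(l := vscale V c x)) 1
        - formal_scale c (Poly_Mapping.single (t(l := x)) 1)
      | t l x c. (\<forall>m. t m \<in> A) \<and> x \<in> A}"
      by blast
  next
    assume "r \<in> {Poly_Mapping.single (t(l := vscale V c x)) 1
        - formal_scale c (Poly_Mapping.single (t(l := x)) 1)
      | t l x c. (\<forall>m. t m \<in> A) \<and> x \<in> A}"
    then obtain t l x c where t: "\<forall>m. t m \<in> A" and x: "x \<in> A"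
      and r: "r = Poly_Mapping.single (t(l := vscale V c x)) 1
        - formal_scale c (Poly_Mapping.single (t(l := x)) 1)" by blast
    obtain u l' g where u: "\<forall>m. u m \<in> A" and g: "\<And>x. x \<in> A \<Longrightarrow> g x \<in> A"
      "\<And>x. x \<in> A \<Longrightarrow> \<phi> (t(l := x)) = u(l' := g x)"
      "\<And>c x. x \<in> A \<Longrightarrow> g (vscale V c x) = vscale V c (g x)"
      by (rule slotwise_linearE[OF \<phi> t, of l]) blast
    have "formal_map \<phi> r = Poly_Mapping.single (u(l' := vscale V c (g x))) 1
        - formal_scale c (Poly_Mapping.single (u(l' := g x)) 1)"
      unfolding r f.diff f.scale formal_map_single by (simp add: g x subspace_closed(5)[OF A])
    with u g(1)[OF x] show "formal_map \<phi> r \<in> {Poly_Mapping.single (t(l := x + y)) 1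
        - Poly_Mapping.single (t(l := x)) 1 - Poly_Mapping.single (t(l := y)) 1
      | t l x y. (\<forall>m. t m \<in> A) \<and> x \<in> A \<and> y \<in> A} \<union>
     {Poly_Mapping.single (t(l := vscale V c x)) 1
        - formal_scale c (Poly_Mapping.single (t(l := x)) 1)
      | t l x c. (\<forall>m. t m \<in> A) \<and> x \<in> A}"
      by blast
  qed
  then have "formal.span (formal_map \<phi> ` multilinear_relations V A)
      \<subseteq> formal.span (multilinear_relations V A)"
    by (intro formal.span_mono) blast
  then show ?thesis
    using p unfolding f.span_image by blast
qed

lemma tensor_map_pure:
  fixes t :: "'n::finite \<Rightarrow> 'v"
  assumes A: "subvertex_algebra V A" and \<phi>: "slotwise_linear V A \<phi>" and t: "\<forall>l. t l \<in> A"
  shows "tensor_map V A \<phi> (pure_tensor V A t) = pure_tensor V A (\<phi> t)"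
proof -
  interpret f: Vector_Spaces.linear formal_scale formal_scale "formal_map \<phi>"
    by (rule formal_map_linear)
  have keys: "formal_map \<phi> p \<in> formal_sums A" if p: "p \<in> formal_sums A"
    for p :: "('n \<Rightarrow> 'v) \<Rightarrow>\<^sub>0 complex"
  proof -
    have "Poly_Mapping.keys (formal_map \<phi> p)
        \<subseteq> (\<Union>t\<in>Poly_Mapping.keys p. Poly_Mapping.keys (Poly_Mapping.single (\<phi> t) (Poly_Mapping.lookup p t)))"
      unfolding formal_map_def by (rule keys_sum)
    also have "\<dots> \<subseteq> \<phi> ` Poly_Mapping.keys p"
      by auto
    finally show ?thesis
      using p slotwise_linear_preserves[OF \<phi>] unfolding formal_sums_def by blast
  qed
  let ?R = "tensor_rel V A :: ((('n \<Rightarrow> 'v) \<Rightarrow>\<^sub>0 complex) \<times> _) set"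
  have "(\<lambda>p. ?R `` {formal_map \<phi> p}) respects ?R"
  proof (rule congruentI)
    fix p q assume "(p, q) \<in> ?R"
    then have "(formal_map \<phi> p, formal_map \<phi> q) \<in> ?R"
      using formal_map_span_relations[OF A \<phi>, of "p - q"] keys
      by (auto simp: tensor_rel_def f.diff)
    then show "?R `` {formal_map \<phi> p} = ?R `` {formal_map \<phi> q}"
      by (rule equiv_class_eq[OF equiv_tensor_rel])
  qed
  from UN_equiv_class[OF equiv_tensor_rel this single_formal_sums[OF t]] show ?thesis
    unfolding tensor_map_def pure_tensor_def formal_map_single .
qed

lemma pure_tensor_relation:
  fixes t :: "'n::finite \<Rightarrow> 'v"
  assumes "\<forall>l. t l \<in> A" and "x \<in> A" and "y \<in> A"
  shows "Poly_Mapping.single (t(k := x + y)) 1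
    - (Poly_Mapping.single (t(k := x)) 1 + Poly_Mapping.single (t(k := y)) 1)
     \<in> formal.span (multilinear_relations V A)"
proof -
  have "Poly_Mapping.single (t(k := x + y)) 1
    - Poly_Mapping.single (t(k := x)) 1 - Poly_Mapping.single (t(k := y)) 1
     \<in> multilinear_relations V A"
    unfolding multilinear_relations_def using assms by blast
  then show ?thesis
    using formal.span_base by (simp add: diff_diff_add)
qed

lemma tensor_add_pure:
  fixes t :: "'n::finite \<Rightarrow> 'v"
  assumes A: "subvertex_algebra V A" and t: "\<forall>l. t l \<in> A" and x: "x \<in> A" and y: "y \<in> A"
  shows "tensor_add V A (pure_tensor V A (t(k := x))) (pure_tensor V A (t(k := y)))
    = pure_tensor V A (t(k := x + y))"
proof -
  let ?R = "tensor_rel V A :: ((('n \<Rightarrow> 'v) \<Rightarrow>\<^sub>0 complex) \<times> _) set"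
  let ?s = "\<lambda>x. Poly_Mapping.single (t(k := x)) (1::complex)"
  have resp: "congruent2 ?R ?R (\<lambda>p q. ?R `` {p + q})"
  proof (rule congruent2I')
    fix p p' q q' assume R: "(p, p') \<in> ?R" "(q, q') \<in> ?R"
    have "(p - p') + (q - q') = (p + q) - (p' + q')"
      by (simp add: algebra_simps)
    moreover have "(p - p') + (q - q') \<in> formal.span (multilinear_relations V A)"
      by (rule formal.span_add) (use R in \<open>simp_all add: tensor_rel_def\<close>)
    ultimately have "(p + q) - (p' + q') \<in> formal.span (multilinear_relations V A)"
      by (simp only:)
    then have "(p + q, p' + q') \<in> ?R"
      using R by (simp add: tensor_rel_def formal_sums_add)
    then show "?R `` {p + q} = ?R `` {p' + q'}"
      by (rule equiv_class_eq[OF equiv_tensor_rel])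
  qed
  have s: "?s z \<in> formal_sums A" if "z \<in> A" for z
    using t that by (intro single_formal_sums) simp
  have "tensor_add V A (pure_tensor V A (t(k := x))) (pure_tensor V A (t(k := y)))
      = ?R `` {?s x + ?s y}"
    unfolding tensor_add_def pure_tensor_def
    by (rule UN_equiv_class2[OF equiv_tensor_rel equiv_tensor_rel resp s[OF x] s[OF y]])
  also have "\<dots> = ?R `` {?s (x + y)}"
  proof (rule equiv_class_eq[OF equiv_tensor_rel, symmetric])
    show "(?s (x + y), ?s x + ?s y) \<in> ?R"
      unfolding tensor_rel_def using pure_tensor_relation[OF t x y] s x y
        subspace_closed(3)[OF A x y] by (simp add: formal_sums_add)
  qed
  finally show ?thesis unfolding pure_tensor_def .
qed

lemma tensor_diff_pure:
  fixes t :: "'n::finite \<Rightarrow> 'v"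
  assumes A: "subvertex_algebra V A" and t: "\<forall>l. t l \<in> A" and x: "x \<in> A" and y: "y \<in> A"
  shows "tensor_diff V A (pure_tensor V A (t(k := x))) (pure_tensor V A (t(k := y)))
    = pure_tensor V A (t(k := x - y))"
proof -
  let ?R = "tensor_rel V A :: ((('n \<Rightarrow> 'v) \<Rightarrow>\<^sub>0 complex) \<times> _) set"
  let ?s = "\<lambda>x. Poly_Mapping.single (t(k := x)) (1::complex)"
  have xy: "x - y \<in> A" by (rule subspace_closed(4)[OF A x y])
  have resp: "congruent2 ?R ?R (\<lambda>p q. ?R `` {p - q})"
  proof (rule congruent2I')
    fix p p' q q' assume R: "(p, p') \<in> ?R" "(q, q') \<in> ?R"
    have "(p - p') - (q - q') = (p - q) - (p' - q')"
      by (simp add: algebra_simps)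
    moreover have "(p - p') - (q - q') \<in> formal.span (multilinear_relations V A)"
      by (rule formal.span_diff) (use R in \<open>simp_all add: tensor_rel_def\<close>)
    ultimately have "(p - q) - (p' - q') \<in> formal.span (multilinear_relations V A)"
      by (simp only:)
    then have "(p - q, p' - q') \<in> ?R"
      using R by (simp add: tensor_rel_def formal_sums_diff)
    then show "?R `` {p - q} = ?R `` {p' - q'}"
      by (rule equiv_class_eq[OF equiv_tensor_rel])
  qed
  have s: "?s z \<in> formal_sums A" if "z \<in> A" for z
    using t that by (intro single_formal_sums) simp
  have "tensor_diff V A (pure_tensor V A (t(k := x))) (pure_tensor V A (t(k := y)))
      = ?R `` {?s x - ?s y}"
    unfolding tensor_diff_def pure_tensor_def
    by (rule UN_equiv_class2[OF equiv_tensor_rel equiv_tensor_rel resp s[OF x] s[OF y]])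
  also have "\<dots> = ?R `` {?s (x - y)}"
  proof (rule equiv_class_eq[OF equiv_tensor_rel])
    have "?s x - ?s y - ?s (x - y) \<in> formal.span (multilinear_relations V A)"
      using pure_tensor_relation[OF t xy y, of k] by (simp add: algebra_simps)
    then show "(?s x - ?s y, ?s (x - y)) \<in> ?R"
      unfolding tensor_rel_def using s x y xy by (simp add: formal_sums_diff)
  qed
  finally show ?thesis unfolding pure_tensor_def .
qed

lemma pure_tensor_in_tensor_power:
  fixes t :: "'n::finite \<Rightarrow> 'v"
  shows "\<forall>l. t l \<in> A \<Longrightarrow> pure_tensor V A t \<in> tensor_power V A"
  unfolding pure_tensor_def tensor_power_def by (intro quotientI single_formal_sums)

end

lemma slotwise_linear_contract:
  fixes V :: "('v::ab_group_add, 'm) vertex_alg_scheme" and i j :: 'n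
  assumes "i \<noteq> j" and "v \<in> A"
    and closed: "\<And>x y. \<lbrakk>x \<in> A; y \<in> A\<rbrakk> \<Longrightarrow> f x y \<in> A"
    and add: "\<And>x y z. \<lbrakk>x \<in> A; y \<in> A; z \<in> A\<rbrakk> \<Longrightarrow> f (x + y) z = f x z + f y z"
      "\<And>x y z. \<lbrakk>x \<in> A; y \<in> A; z \<in> A\<rbrakk> \<Longrightarrow> f z (x + y) = f z x + f z y"
    and scale: "\<And>c x z. \<lbrakk>x \<in> A; z \<in> A\<rbrakk> \<Longrightarrow> f (vscale V c x) z = vscale V c (f x z)"
      "\<And>c x z. \<lbrakk>x \<in> A; z \<in> A\<rbrakk> \<Longrightarrow> f z (vscale V c x) = vscale V c (f z x)"
  shows "slotwise_linear V A (\<lambda>t. t(i := v, j := f (t i) (t j)))"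
  unfolding slotwise_linear_def
proof (intro allI impI)
  fix t :: "'n \<Rightarrow> 'v" and l assume t: "\<forall>m. t m \<in> A"
  consider "l = i" | "l = j" | "l \<noteq> i" "l \<noteq> j" by blast
  then show "\<exists>u l' g. (\<forall>m. u m \<in> A)
      \<and> (\<forall>x\<in>A. g x \<in> A
          \<and> (t(l := x))(i := v, j := f ((t(l := x)) i) ((t(l := x)) j)) = u(l' := g x))
      \<and> (\<forall>x\<in>A. \<forall>y\<in>A. g (x + y) = g x + g y)
      \<and> (\<forall>c. \<forall>x\<in>A. g (vscale V c x) = vscale V c (g x))"
  proof cases
    case 1
    then show ?thesis
      using assms t
      by (intro exI[of _ "t(i := v)"] exI[of _ j] exI[of _ "\<lambda>x. f x (t j)"]) auto
  next
    case 2
    then show ?thesis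
      using assms t
      by (intro exI[of _ "t(i := v)"] exI[of _ j] exI[of _ "\<lambda>x. f (t i) x"])
        (auto simp: fun_upd_twist)
  next
    case 3
    then show ?thesis
      using assms t
      by (intro exI[of _ "t(i := v, j := f (t i) (t j))"] exI[of _ l] exI[of _ "\<lambda>x. x"])
        (auto simp: fun_eq_iff)
  qed
qed

lemma slotwise_linear_slot:
  fixes V :: "('v::ab_group_add, 'm) vertex_alg_scheme" and k :: 'n
  assumes closed: "\<And>x. x \<in> A \<Longrightarrow> f x \<in> A"
    and add: "\<And>x y. \<lbrakk>x \<in> A; y \<in> A\<rbrakk> \<Longrightarrow> f (x + y) = f x + f y"
    and scale: "\<And>c x. x \<in> A \<Longrightarrow> f (vscale V c x) = vscale V c (f x)"
  shows "slotwise_linear V A (\<lambda>t. t(k := f (t k)))"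
  unfolding slotwise_linear_def
proof (intro allI impI)
  fix t :: "'n \<Rightarrow> 'v" and l assume t: "\<forall>m. t m \<in> A"
  show "\<exists>u l' g. (\<forall>m. u m \<in> A)
      \<and> (\<forall>x\<in>A. g x \<in> A \<and> (t(l := x))(k := f ((t(l := x)) k)) = u(l' := g x))
      \<and> (\<forall>x\<in>A. \<forall>y\<in>A. g (x + y) = g x + g y)
      \<and> (\<forall>c. \<forall>x\<in>A. g (vscale V c x) = vscale V c (g x))"
  proof (cases "l = k")
    case True
    then show ?thesis
      using assms t by (intro exI[of _ t] exI[of _ k] exI[of _ f]) auto
  next
    case False
    then show ?thesis
      using assms t
      by (intro exI[of _ "t(k := f (t k))"] exI[of _ l] exI[of _ "\<lambda>x. x"])
        (auto simp: fun_eq_iff)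
  qed
qed

context dijkgraaf_subalgebra
begin

lemma B_op_pure:
  fixes t :: "'n::finite \<Rightarrow> 'v"
  assumes "i \<noteq> j" and "\<forall>l. t l \<in> A"
  shows "B_op V A i j (pure_tensor V A t)
    = pure_tensor V A (t(i := vacuum V, j := B_prod V A (t i) (t j)))"
proof -
  have "slotwise_linear V A (\<lambda>t. t(i := vacuum V, j := B_prod V A (t i) (t j)))"
    by (rule slotwise_linear_contract[OF assms(1)])
      (auto intro: closed B_closed B_bilinear(1,2) B_bilinear(3)[OF _ closed(2)]
        B_bilinear(4)[OF _ closed(2)])
  from tensor_map_pure[OF subalgebra this assms(2)] show ?thesis
    unfolding B_op_def .
qed

lemma C_op_pure:
  fixes t :: "'n::finite \<Rightarrow> 'v"
  assumes "i \<noteq> j" and "\<forall>l. t l \<in> A"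
  shows "C_op V A i j (pure_tensor V A t)
    = pure_tensor V A (t(i := vacuum V, j := C_prod V A (t i) (t j)))"
proof -
  have "slotwise_linear V A (\<lambda>t. t(i := vacuum V, j := C_prod V A (t i) (t j)))"
    by (rule slotwise_linear_contract[OF assms(1)])
      (auto intro: closed C_closed C_bilinear(1,2) C_bilinear(3)[OF _ closed(2)]
        C_bilinear(4)[OF _ closed(2)])
  from tensor_map_pure[OF subalgebra this assms(2)] show ?thesis
    unfolding C_op_def .
qed

lemma T_op_pure:
  fixes t :: "'n::finite \<Rightarrow> 'v"
  assumes "\<forall>l. t l \<in> A"
  shows "T_op V A k (pure_tensor V A t) = pure_tensor V A (t(k := transl V (t k)))"
proof -
  have "slotwise_linear V A (\<lambda>t :: 'n \<Rightarrow> 'v. t(k := transl V (t k)))"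
    by (rule slotwise_linear_slot) (simp_all add: closed transl_simps)
  from tensor_map_pure[OF subalgebra this assms] show ?thesis
    unfolding T_op_def .
qed

end

theorem theorem1p1:
  fixes V :: "('v::ab_group_add, 'm) conformal_vertex_alg_scheme"
    and A :: "'v set"
    and a :: "'n::finite \<Rightarrow> 'v"
    and i j k :: 'n
  assumes "graded_conformal_vertex_algebra V"
    and "subvertex_algebra V A"
    and "graded_subset V A"
    and "dijkgraaf V A"
    and "\<forall>l. a l \<in> A"
    and "i \<noteq> j" and "i \<noteq> k" and "j \<noteq> k"
  shows
    "(B_op V A i k (B_op V A j k (pure_tensor V A a))
       = B_op V A j k (B_op V A i k (pure_tensor V A a)))
     \<and> (tensor_add V A
       (tensor_commutator V A (C_op V A i k) (B_op V A j k) (pure_tensor V A a))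
       (B_op V A i k (B_op V A j k (pure_tensor V A a)))
     = B_op V A j k (C_op V A i j (pure_tensor V A a)))
     \<and> (tensor_diff V A
       (tensor_commutator V A (C_op V A i k) (C_op V A j k) (pure_tensor V A a))
       (tensor_diff V A
          (C_op V A j k (C_op V A i j (pure_tensor V A a)))
          (C_op V A i k (C_op V A j i (pure_tensor V A a))))
     \<in> T_op V A k ` tensor_power V A)"
proof -
  interpret graded_conformal_vertex_algebra V by fact
  interpret dijkgraaf_subalgebra V A by unfold_locales fact+
  \<comment> \<open>The common tuple: two of the operators always leave the vacuum in slots \<open>i\<close> and \<open>j\<close>.\<close>
  define u where "u = a(i := vacuum V, j := vacuum V)"
  define P where "P x = pure_tensor V A (u(k := x))" for x
  note a = assms(5)[rule_format]
  note neq = assms(6-8) assms(6-8)[symmetric]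
  have u: "\<forall>l. u l \<in> A" using a closed(2) by (simp add: u_def)
  have ijk: "a(j := vacuum V, k := x, i := vacuum V, k := y) = u(k := y)"
    "a(i := vacuum V, k := x, j := vacuum V, k := y) = u(k := y)"
    "a(i := vacuum V, j := vacuum V, k := y) = u(k := y)"
    "a(j := vacuum V, i := vacuum V, k := y) = u(k := y)" for x y
    using neq by (auto simp: u_def fun_eq_iff)
  let ?a = "a i" and ?b = "a j" and ?c = "a k"
  let ?B = "B_prod V A" and ?C = "C_prod V A"
  note ops = B_op_pure C_op_pure B_closed C_closed a closed neq ijk P_def[symmetric]
  have BB: "B_op V A i k (B_op V A j k (pure_tensor V A a)) = P (?B ?a (?B ?b ?c))"
    "B_op V A j k (B_op V A i k (pure_tensor V A a)) = P (?B ?b (?B ?a ?c))"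
    by (simp_all add: ops)
  have CB: "C_op V A i k (B_op V A j k (pure_tensor V A a)) = P (?C ?a (?B ?b ?c))"
    "B_op V A j k (C_op V A i k (pure_tensor V A a)) = P (?B ?b (?C ?a ?c))"
    "B_op V A j k (C_op V A i j (pure_tensor V A a)) = P (?B (?C ?a ?b) ?c)"
    by (simp_all add: ops)
  have CC: "C_op V A i k (C_op V A j k (pure_tensor V A a)) = P (?C ?a (?C ?b ?c))"
    "C_op V A j k (C_op V A i k (pure_tensor V A a)) = P (?C ?b (?C ?a ?c))"
    "C_op V A j k (C_op V A i j (pure_tensor V A a)) = P (?C (?C ?a ?b) ?c)"
    "C_op V A i k (C_op V A j i (pure_tensor V A a)) = P (?C (?C ?b ?a) ?c)"
    by (simp_all add: ops)
  have P_add: "tensor_add V A (P x) (P y) = P (x + y)"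
    and P_diff: "tensor_diff V A (P x) (P y) = P (x - y)" if "x \<in> A" "y \<in> A" for x y
    using tensor_add_pure[OF subalgebra u that] tensor_diff_pure[OF subalgebra u that]
    by (simp_all add: P_def)
  have P_transl: "P x \<in> T_op V A k ` tensor_power V A" if x: "x \<in> transl V ` A" for x
  proof -
    obtain d where d: "d \<in> A" "x = transl V d" using x by blast
    then have d_mem: "\<forall>l. (u(k := d)) l \<in> A" using u by simp
    have "P x = T_op V A k (P d)"
      using T_op_pure[where t = "u(k := d)", OF d_mem] by (simp add: P_def d)
    moreover have "P d \<in> tensor_power V A"
      unfolding P_def by (rule pure_tensor_in_tensor_power) (rule d_mem)
    ultimately show ?thesis by blast
  qed
  show ?thesis
    unfolding tensor_commutator_def BB CB CC
    using B_commute(2)[OF a a a, of i j k] C_B_identity[OF a a a, of i j k]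
      P_transl[OF C_C_identity[OF a a a, of i j k]]
    by (simp add: P_add P_diff a closed B_closed C_closed)
qed

end
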